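(* Let $\mathcal{S}=(A,B,C,\mathcal{N},\mathcal{M})$ be a BQO system of order $n$ and $\widehat{\mathcal{S}}=(\widehat A,\widehat B,\widehat C,\widehat{\mathcal{N}},\widehat{\mathcal{M}})$ a BQO system of order $r$, both with $m$ inputs and $p$ outputs, with $A$ and $\widehat A$ stable and with associated stability parameters $\alpha,\beta$ and $\widehat\alpha,\widehat\beta$. Assume that $\|\mathcal{N}\|^2,\|\mathcal{N}_T\|^2<2\alpha/\beta^2$ and $\|\widehat{\mathcal{N}}\|^2,\|\widehat{\mathcal{N}}_T\|^2<2\widehat\alpha/\widehat\beta^2$. Then the $\mathcal{H}_2$ inner product of $\mathcal{S}$ and $\widehat{\mathcal{S}}$ is given by $$\langle \mathcal{S},\widehat{\mathcal{S}}\rangle_{\mathcal{H}_2}=\operatorname{tr}(CX\widehat C^T)+\sum_{j=1}^p\operatorname{tr}(X^TM_jX\widehat M_j)=-\operatorname{tr}(B^TY\widehat B),$$ where $X,Y\in\mathbb{R}^{n\times r}$ are the unique solutions of $$AX+X\widehat A^T+\sum_{k=1}^mN_kX\widehat N_k^T+B\widehat B^T=0,$$ $$A^TY+Y\widehat A+\sum_{k=1}^mN_k^TY\widehat N_k-\sum_{j=1}^pM_jX\widehat M_j-C^T\widehat C=0.$$ If $\mathcal{S}=\widehat{\mathcal{S}}$, then $X=P$ and $Y=-Q$, where $P,Q\in\mathbb{R}^{n\times n}$ are the unique solutions of $$AP+PA^T+\sum_{k=1}^mN_kPN_k^T+BB^T=0,$$ $$A^TQ+QA+\sum_{k=1}^mN_k^TQN_k+\sum_{j=1}^pM_jPM_j+C^TC=0,$$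 and the $\mathcal{H}_2$ norm of $\mathcal{S}$ is given by $$\|\mathcal{S}\|_{\mathcal{H}_2}^2=\operatorname{tr}(CPC^T)+\sum_{j=1}^p\operatorname{tr}(PM_jPM_j)=\operatorname{tr}(B^TQB).$$
   Context: A BQO (bilinear quadratic output) system of order $n$ with $m$ inputs and $p$ outputs is given by real matrices $A\in\mathbb{R}^{n\times n}$, $B\in\mathbb{R}^{n\times m}$, $C\in\mathbb{R}^{p\times n}$, $N_1,\dots,N_m\in\mathbb{R}^{n\times n}$ and symmetric $M_1,\dots,M_p\in\mathbb{R}^{n\times n}$, and represents $\dot x=Ax+\sum_k N_kxu_k+Bu$, $x(0)=0$, $y=Cx+[x^TM_1x,\dots,x^TM_px]^T$. Write $\mathcal{S}=(A,B,C,\mathcal{N},\mathcal{M})$ with $\mathcal{N}=[N_1\,\dots\,N_m]\in\mathbb{R}^{n\times nm}$, $\mathcal{M}=[M_1\,\dots\,M_p]$, and set $\mathcal{N}_T=[N_1^T\,\dots\,N_m^T]\in\mathbb{R}^{n\times nm}$ and $\mathfrak{M}=[\operatorname{vec}(M_1)\,\dots\,\operatorname{vec}(M_p)]^T\in\mathbb{R}^{p\times n^2}$, where $\operatorname{vec}$ stacks columns. Hatted quantities denote the analogous objects of the system $\widehat{\mathcal{S}}$ of order $r$. $\|\cdot\|$ is the spectral norm and $\|\cdot\|_F$ the Frobenius norm. $A$ is stable if all its eigenvalues have negative real part; stability parameters $\alpha,\beta$ of a stable $A$ are constants $\beta>0$ and $0<\alpha\le-\max_i\operatorname{Re}(\lambda_i(A))$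 with $\|e^{At}\|\le\beta e^{-\alpha t}$ for all $t\ge0$ (similarly $\widehat\alpha,\widehat\beta$ for $\widehat A$). Reachability mapping: $\bar P_1(t_1)=e^{At_1}B\in\mathbb{R}^{n\times m}$ and $\bar P_i(t_1,\dots,t_i)=e^{At_i}\mathcal{N}(I_m\otimes\bar P_{i-1}(t_1,\dots,t_{i-1}))\in\mathbb{R}^{n\times m^i}$ for $i\ge2$; $\widehat{\bar P}_i$ is defined analogously from $\widehat A,\widehat B,\widehat{\mathcal{N}}$. Volterra kernels: $h_{C,i}(t_1,\dots,t_i)=C\bar P_i(t_1,\dots,t_i)$ and $h_{M,i,j}(t_1,\dots,t_i,\bar t_1,\dots,\bar t_j)=\mathfrak{M}(\bar P_i(t_1,\dots,t_i)\otimes\bar P_j(\bar t_1,\dots,\bar t_j))$; analogously $\widehat h_{\widehat C,i}$ and $\widehat h_{\widehat M,i,j}$ for $\widehat{\mathcal{S}}$. The $\mathcal{H}_2$ inner product is $$\langle\mathcal{S},\widehat{\mathcal{S}}\rangle_{\mathcal{H}_2}=\sum_{i=1}^\infty\int_0^\infty\!\!\cdots\!\int_0^\infty\operatorname{tr}(h_{C,i}\widehat h_{\widehat C,i}^T)\,dt_1\cdots dt_i+\sum_{i,j=1}^\infty\int_0^\infty\!\!\cdots\!\int_0^\infty\operatorname{tr}(h_{M,i,j}\widehat h_{\widehat M,i,j}^T)\,dt_1\cdots dt_i\,d\bar t_1\cdots d\bar t_j,$$ and the $\mathcal{H}_2$ norm is given by $\|\mathcal{S}\|_{\mathcal{H}_2}^2=\langle\mathcal{S},\mathcal{S}\rangle_{\mathcal{H}_2}$,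 i.e. with integrands $\|h_{C,i}\|_F^2$ and $\|h_{M,i,j}\|_F^2$. The matrix $X$ can equivalently be written $X=\sum_{i=1}^\infty\int_0^\infty\cdots\int_0^\infty\bar P_i\widehat{\bar P}_i^T\,dt_1\cdots dt_i$. *)

theory Defs
  imports "HOL-Analysis.Analysis"
begin

text \<open>A BQO system of order \<open>CARD('n)\<close> with \<open>CARD('m)\<close> inputs and \<open>CARD('p)\<close> outputs.
  The symmetry of the matrices \<open>sysM S j\<close> is the separate predicate \<open>bqo_system\<close>.\<close>

record ('n::finite, 'm::finite, 'p::finite) bqo =
  sysA :: "real^'n^'n"
  sysB :: "real^'m^'n"
  sysC :: "real^'n^'p"
  sysN :: "'m \<Rightarrow> real^'n^'n"
  sysM :: "'p \<Rightarrow> real^'n^'n"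

definition bqo_system :: "('n::finite, 'm::finite, 'p::finite) bqo \<Rightarrow> bool" where
  "bqo_system S \<longleftrightarrow> (\<forall>j. transpose (sysM S j) = sysM S j)"

text \<open>Block row \<open>[N\<^sub>1 \<dots> N\<^sub>m]\<close>; the column index \<open>(k, l)\<close> is column \<open>l\<close> of block \<open>k\<close>.\<close>

definition block_row :: "('m::finite \<Rightarrow> real^'n^'n) \<Rightarrow> real^('m \<times> 'n)^'n" where
  "block_row N = (\<chi> i kl. N (fst kl) $ i $ snd kl)"

definition calN :: "('n::finite, 'm::finite, 'p::finite) bqo \<Rightarrow> real^('m \<times> 'n)^'n" where
  "calN S = block_row (sysN S)"

definition calN_T :: "('n::finite, 'm::finite, 'p::finite) bqo \<Rightarrow> real^('m \<times> 'n)^'n" where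
  "calN_T S = block_row (\<lambda>k. transpose (sysN S k))"

text \<open>Stacking of columns: index \<open>(c, r)\<close> of \<open>vec_mat M\<close> is row \<open>r\<close> of column \<open>c\<close> of \<open>M\<close>.\<close>

definition vec_mat :: "real^'c^'r \<Rightarrow> real^('c::finite \<times> 'r::finite)" where
  "vec_mat M = (\<chi> cr. M $ snd cr $ fst cr)"

definition frakM :: "('n::finite, 'm::finite, 'p::finite) bqo \<Rightarrow> real^('n \<times> 'n)^'p" where
  "frakM S = (\<chi> j. vec_mat (sysM S j))"

definition spectral_norm :: "real^'n^'k \<Rightarrow> real" where
  "spectral_norm M = onorm ((*v) M)"

definition mat_exp :: "real^'n^'n \<Rightarrow> real^'n^'n" where
  "mat_exp A = (\<Sum>k. (1 / fact k) *\<^sub>R (((**) A ^^ k) (mat 1)))"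

text \<open>The complex spectrum of a real matrix.\<close>

definition eigenvalues :: "real^'n^'n \<Rightarrow> complex set" where
  "eigenvalues A = {l. \<exists>v. v \<noteq> 0 \<and> (\<chi> i j. complex_of_real (A $ i $ j)) *v v = l *s v}"

definition stable_mat :: "real^'n^'n \<Rightarrow> bool" where
  "stable_mat A \<longleftrightarrow> (\<forall>l \<in> eigenvalues A. Re l < 0)"

definition stability_params :: "real^'n^'n \<Rightarrow> real \<Rightarrow> real \<Rightarrow> bool" where
  "stability_params A \<alpha> \<beta> \<longleftrightarrow>
     \<beta> > 0 \<and> 0 < \<alpha> \<and> \<alpha> \<le> - Max (Re ` eigenvalues A) \<and>
     (\<forall>t\<ge>0. spectral_norm (mat_exp (t *\<^sub>R A)) \<le> \<beta> * exp (- \<alpha> * t))"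

text \<open>The number of columns of the reachability mapping, \<open>m\<^sup>i\<close>, varies with \<open>i\<close>. A matrix with
  rows in the finite type \<open>'n\<close> is therefore represented by its family of columns
  \<open>'c \<Rightarrow> real^'n\<close>, together with the set of column indices in use. The \<open>m\<^sup>i\<close> columns are indexed
  by the words of length \<open>i\<close> over \<open>'m\<close>; the Kronecker product indices \<open>(k, w)\<close>
  are identified with the words \<open>k # w\<close> (lexicographic ordering of the columns).\<close>

definition words :: "nat \<Rightarrow> 'm list set" where
  "words i = {w. length w = i}"

definition mult_cols :: "real^'n^'k \<Rightarrow> ('c \<Rightarrow> real^'n) \<Rightarrow> 'c \<Rightarrow> real^'k" where
  "mult_cols A F = (\<lambda>c. A *v F c)"

definition id_cols :: "'m::finite \<Rightarrow> real^'m" where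
  "id_cols = (\<lambda>k. column k (mat 1))"

definition kron_cols ::
  "('c \<Rightarrow> real^'n) \<Rightarrow> ('d \<Rightarrow> real^'k) \<Rightarrow> 'c \<times> 'd \<Rightarrow> real^('n::finite \<times> 'k::finite)" where
  "kron_cols F G = (\<lambda>(c, d). \<chi> ab. F c $ fst ab * G d $ snd ab)"

text \<open>The product \<open>F G\<^sup>T\<close> of matrices with column index set \<open>W\<close>.\<close>

definition mult_transpose_cols ::
  "'c set \<Rightarrow> ('c \<Rightarrow> real^'q) \<Rightarrow> ('c \<Rightarrow> real^'k) \<Rightarrow> real^'k^'q" where
  "mult_transpose_cols W F G = (\<chi> a b. \<Sum>c\<in>W. F c $ a * G c $ b)"

text \<open>Reachability mapping; the times \<open>t\<^sub>1, \<dots>, t\<^sub>i\<close> are the values \<open>t 1, \<dots>, t i\<close>.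
  Indices start at 1, the value at 0 is a dummy.\<close>

fun reach :: "('n::finite, 'm::finite, 'p::finite) bqo \<Rightarrow> nat \<Rightarrow> (nat \<Rightarrow> real) \<Rightarrow> 'm list \<Rightarrow> real^'n"
  where
  "reach S 0 t = (\<lambda>w. 0)"
| "reach S (Suc 0) t = (\<lambda>w. column (hd w) (mat_exp (t 1 *\<^sub>R sysA S) ** sysB S))"
| "reach S (Suc (Suc i)) t =
     (\<lambda>w. mult_cols (mat_exp (t (Suc (Suc i)) *\<^sub>R sysA S) ** calN S)
            (kron_cols id_cols (reach S (Suc i) t)) (hd w, tl w))"

definition kernel_C ::
  "('n::finite, 'm::finite, 'p::finite) bqo \<Rightarrow> nat \<Rightarrow> (nat \<Rightarrow> real) \<Rightarrow> 'm list \<Rightarrow> real^'p" where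
  "kernel_C S i t = mult_cols (sysC S) (reach S i t)"

definition kernel_M ::
  "('n::finite, 'm::finite, 'p::finite) bqo \<Rightarrow> nat \<Rightarrow> nat \<Rightarrow> (nat \<Rightarrow> real) \<Rightarrow> (nat \<Rightarrow> real)
     \<Rightarrow> 'm list \<times> 'm list \<Rightarrow> real^'p" where
  "kernel_M S i j t s = mult_cols (frakM S) (kron_cols (reach S i t) (reach S j s))"

text \<open>The integrals over \<open>t\<^sub>1, \<dots>, t\<^sub>i \<ge> 0\<close> are Lebesgue integrals over the orthant.\<close>

definition time_measure :: "nat \<Rightarrow> (nat \<Rightarrow> real) measure" where
  "time_measure i = (\<Pi>\<^sub>M k\<in>{1..i}. lborel)"

definition time_orthant :: "nat \<Rightarrow> (nat \<Rightarrow> real) set" where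
  "time_orthant i = (\<Pi>\<^sub>E k\<in>{1..i}. {0..})"

definition integrand_C ::
  "('n::finite, 'm::finite, 'p::finite) bqo \<Rightarrow> ('r::finite, 'm, 'p) bqo \<Rightarrow> nat
     \<Rightarrow> (nat \<Rightarrow> real) \<Rightarrow> real" where
  "integrand_C S S' i t =
     trace (mult_transpose_cols (words i) (kernel_C S i t) (kernel_C S' i t))"

definition integrand_M ::
  "('n::finite, 'm::finite, 'p::finite) bqo \<Rightarrow> ('r::finite, 'm, 'p) bqo \<Rightarrow> nat \<Rightarrow> nat
     \<Rightarrow> (nat \<Rightarrow> real) \<times> (nat \<Rightarrow> real) \<Rightarrow> real" where
  "integrand_M S S' i j = (\<lambda>(t, s).
     trace (mult_transpose_cols (words i \<times> words j) (kernel_M S i j t s) (kernel_M S' i j t s)))"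

definition h2_term_C ::
  "('n::finite, 'm::finite, 'p::finite) bqo \<Rightarrow> ('r::finite, 'm, 'p) bqo \<Rightarrow> nat \<Rightarrow> real" where
  "h2_term_C S S' i = (LINT t:time_orthant i|time_measure i. integrand_C S S' i t)"

definition h2_term_M ::
  "('n::finite, 'm::finite, 'p::finite) bqo \<Rightarrow> ('r::finite, 'm, 'p) bqo \<Rightarrow> nat \<Rightarrow> nat \<Rightarrow> real" where
  "h2_term_M S S' i j =
     (LINT ts:time_orthant i \<times> time_orthant j|time_measure i \<Otimes>\<^sub>M time_measure j.
        integrand_M S S' i j ts)"

definition h2_inner ::
  "('n::finite, 'm::finite, 'p::finite) bqo \<Rightarrow> ('r::finite, 'm, 'p) bqo \<Rightarrow> real" where
  "h2_inner S S' =
     (\<Sum>\<^sub>\<infinity>i\<in>{1..}. h2_term_C S S' i) +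
     (\<Sum>\<^sub>\<infinity>(i, j)\<in>{1..} \<times> {1..}. h2_term_M S S' i j)"

text \<open>Integrals and infinite sums are total in HOL; \<open>h2_inner S S'\<close> is meaningful when
  everything in it converges.\<close>

definition h2_inner_converges ::
  "('n::finite, 'm::finite, 'p::finite) bqo \<Rightarrow> ('r::finite, 'm, 'p) bqo \<Rightarrow> bool" where
  "h2_inner_converges S S' \<longleftrightarrow>
     (\<forall>i\<ge>1. set_integrable (time_measure i) (time_orthant i) (integrand_C S S' i)) \<and>
     (\<forall>i\<ge>1. \<forall>j\<ge>1. set_integrable (time_measure i \<Otimes>\<^sub>M time_measure j)
        (time_orthant i \<times> time_orthant j) (integrand_M S S' i j)) \<and>
     (\<lambda>i. h2_term_C S S' i) summable_on {1..} \<and>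
     (\<lambda>(i, j). h2_term_M S S' i j) summable_on {1..} \<times> {1..}"

definition h2_norm :: "('n::finite, 'm::finite, 'p::finite) bqo \<Rightarrow> real" where
  "h2_norm S = sqrt (h2_inner S S)"

definition unique_solution :: "('a \<Rightarrow> bool) \<Rightarrow> 'a \<Rightarrow> bool" where
  "unique_solution E x \<longleftrightarrow> E x \<and> (\<forall>y. E y \<longrightarrow> y = x)"

definition X_equation ::
  "('n::finite, 'm::finite, 'p::finite) bqo \<Rightarrow> ('r::finite, 'm, 'p) bqo \<Rightarrow> real^'r^'n \<Rightarrow> bool" where
  "X_equation S S' X \<longleftrightarrow>
     sysA S ** X + X ** transpose (sysA S')
     + (\<Sum>k\<in>UNIV. sysN S k ** X ** transpose (sysN S' k))
     + sysB S ** transpose (sysB S') = 0"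

definition Y_equation ::
  "('n::finite, 'm::finite, 'p::finite) bqo \<Rightarrow> ('r::finite, 'm, 'p) bqo
     \<Rightarrow> real^'r^'n \<Rightarrow> real^'r^'n \<Rightarrow> bool" where
  "Y_equation S S' X Y \<longleftrightarrow>
     transpose (sysA S) ** Y + Y ** sysA S'
     + (\<Sum>k\<in>UNIV. transpose (sysN S k) ** Y ** sysN S' k)
     - (\<Sum>j\<in>UNIV. sysM S j ** X ** sysM S' j)
     - transpose (sysC S) ** sysC S' = 0"

definition P_equation :: "('n::finite, 'm::finite, 'p::finite) bqo \<Rightarrow> real^'n^'n \<Rightarrow> bool" where
  "P_equation S P \<longleftrightarrow>
     sysA S ** P + P ** transpose (sysA S)
     + (\<Sum>k\<in>UNIV. sysN S k ** P ** transpose (sysN S k))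
     + sysB S ** transpose (sysB S) = 0"

definition Q_equation ::
  "('n::finite, 'm::finite, 'p::finite) bqo \<Rightarrow> real^'n^'n \<Rightarrow> real^'n^'n \<Rightarrow> bool" where
  "Q_equation S P Q \<longleftrightarrow>
     transpose (sysA S) ** Q + Q ** sysA S
     + (\<Sum>k\<in>UNIV. transpose (sysN S k) ** Q ** sysN S k)
     + (\<Sum>j\<in>UNIV. sysM S j ** P ** sysM S j)
     + transpose (sysC S) ** sysC S = 0"

end

theory Submission
  imports Defs
begin

text \<open>Write \<open>\<Phi>\<^sub>s Z = e\<^bsup>sA\<^esup> Z (e\<^bsup>sA'\<^esup>)\<^sup>T\<close> and \<open>\<N> Z = \<Sum>\<^sub>k N\<^sub>k Z N'\<^sub>k\<^sup>T\<close>, with primes for the second system. The traces of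
products of Volterra kernels depend on the reachability mappings only through the Gram matrices
\<open>G\<^sub>i = P\<^sub>i P'\<^sub>i\<^sup>T\<close>, whose size is independent of \<open>i\<close>: the linear kernels give a linear functional of \<open>G\<^sub>i\<close>
(\<open>integrand_C_eq\<close>), the mixed kernels a bilinear form of \<open>G\<^sub>i\<close> and \<open>G\<^sub>j\<close> in independent time variables
(\<open>integrand_M_eq\<close>). The Gram matrices satisfy \<open>G\<^sub>1 = \<Phi>\<^bsub>t 1\<^esub> (B B'\<^sup>T)\<close> and \<open>G\<^sub>i\<^sub>+\<^sub>1 = \<Phi>\<^bsub>t (i+1)\<^esub> (\<N> G\<^sub>i)\<close>. By Fubini
their integrals over the time orthants are \<open>X\<^sub>1 = \<T> (B B'\<^sup>T)\<close> and \<open>X\<^sub>i\<^sub>+\<^sub>1 = \<T> (\<N> X\<^sub>i)\<close>, where \<open>\<T> Z\<close> is the integral of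
\<open>\<Phi>\<^sub>s Z\<close> over \<open>s \<ge> 0\<close> (\<open>integral_reach_gram\<close>).

Two facts about \<open>\<T>\<close> carry the proof. First, \<open>- \<T>\<close> is the inverse of the Sylvester operator
\<open>\<L> Z = A Z + Z A'\<^sup>T\<close>, by the fundamental theorem of calculus. Secondly, \<open>\<T> \<circ> \<N>\<close>
is a contraction in the spectral norm, with factor \<open>\<beta> \<beta>' \<nu> \<nu>' / (\<alpha> + \<alpha>') < 1\<close>, where \<open>\<nu>\<close> and \<open>\<nu>'\<close>
are the spectral norms of the block rows of the two systems. Hence the generalized Lyapunov operator \<open>\<L> + \<N>\<close> is injective, the Neumann series
\<open>X = \<Sum>\<^sub>i X\<^sub>i\<close> converges absolutely, and \<open>X\<close> is the unique solution of its equation. Summing the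
linear functional and the bilinear form over all kernels gives the trace formula in \<open>X\<close> (\<open>h2_inner_trace\<close>).

The operator in the equation for \<open>Y\<close> is the adjoint of \<open>\<L> + \<N>\<close> for the Frobenius inner product, therefore also
bijective. Moving it from \<open>Y\<close> to \<open>X\<close> turns the trace formula into \<open>- tr (B\<^sup>T Y B')\<close> (\<open>h2_inner_dual\<close>).
For equal systems \<open>X\<close> is symmetric by uniqueness, and the sign of \<open>Y\<close> is switched to obtain \<open>Q\<close>.\<close>

section \<open>Trace, Frobenius inner product and derivatives of matrices\<close>

lemma trace_transpose_mult: "trace (transpose (A::real^'n^'m) ** B) = A \<bullet> B"
  unfolding trace_def transpose_def matrix_matrix_mult_def inner_vec_def
  by (simp, subst sum.swap, simp)

lemma trace_mult: "trace ((A::real^'n^'m) ** B) = transpose A \<bullet> B"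
  by (metis trace_transpose_mult transpose_transpose)

lemma inner_transpose: "transpose (A::real^'n^'m) \<bullet> transpose B = A \<bullet> B"
  unfolding transpose_def inner_vec_def by (simp, subst sum.swap, simp)

text \<open>Left and right multiplication have transposed multiplications as adjoints for the Frobenius
inner product. The adjoint of the generalized Lyapunov operator is read off from these two rules.\<close>

lemma inner_matrix_mult_left: "((A::real^'n^'m) ** X) \<bullet> Y = X \<bullet> (transpose A ** Y)"
  by (simp add: trace_transpose_mult[symmetric] matrix_transpose_mul matrix_mul_assoc)

lemma inner_matrix_mult_right: "((X::real^'n^'m) ** B) \<bullet> Y = X \<bullet> (Y ** transpose B)"
proof -
  have "(X ** B) \<bullet> Y = (transpose B ** transpose X) \<bullet> transpose Y"
    by (simp add: inner_transpose flip: matrix_transpose_mul)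
  also have "\<dots> = transpose X \<bullet> transpose (Y ** transpose B)"
    by (simp add: inner_matrix_mult_left matrix_transpose_mul)
  finally show ?thesis by (simp add: inner_transpose)
qed

lemma trace_sandwich: "trace (C ** (X::real^'r^'n) ** transpose C') = (transpose C ** C') \<bullet> X"
  by (simp add: trace_mult inner_matrix_mult_right[of "transpose C"] flip: matrix_mul_assoc)

lemma bounded_bilinear_matrix_mult: "bounded_bilinear ((**) :: real^'n^'m \<Rightarrow> real^'k^'n \<Rightarrow> real^'k^'m)"
  unfolding bilinear_conv_bounded_bilinear[symmetric] bilinear_def
  by (auto intro!: linearI simp: matrix_matrix_mult_def vec_eq_iff sum.distrib sum_distrib_left algebra_simps)

lemma bounded_linear_transpose: "bounded_linear (transpose :: real^'n^'m \<Rightarrow> _)"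
  unfolding linear_conv_bounded_linear[symmetric]
  by (auto intro!: linearI simp: transpose_def vec_eq_iff)

lemma bounded_linear_trace: "bounded_linear (trace :: real^'n^'n \<Rightarrow> real)"
  unfolding linear_conv_bounded_linear[symmetric]
  by (auto intro!: linearI simp: trace_def sum.distrib sum_distrib_left)

lemma has_vector_derivative_matrix:
  fixes F :: "real \<Rightarrow> real^'n^'m"
  assumes "\<And>i j. ((\<lambda>t. F t $ i $ j) has_real_derivative D $ i $ j) (at t)"
  shows "(F has_vector_derivative D) (at t)"
  unfolding has_vector_derivative_def
  by (subst has_derivative_componentwise_within)
     (use assms in \<open>auto simp: Basis_vec_def inner_axis has_field_derivative_def mult.commute[of _ "D $ _ $ _"]\<close>)

section \<open>Spectral norm\<close>

lemma spectral_norm_nonneg: "0 \<le> spectral_norm (M::real^'n^'m)"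
  unfolding spectral_norm_def by (intro onorm_pos_le matrix_vector_mul_bounded_linear)

lemma norm_mult_le_spectral_norm: "norm (M *v y) \<le> spectral_norm (M::real^'n^'m) * norm y"
  unfolding spectral_norm_def by (intro onorm matrix_vector_mul_bounded_linear)

lemma inner_mult_le_spectral_norm:
  "\<bar>x \<bullet> (M *v y)\<bar> \<le> spectral_norm (M::real^'n^'m) * (norm x * norm y)"
proof -
  have "\<bar>x \<bullet> (M *v y)\<bar> \<le> norm x * norm (M *v y)" by (rule Cauchy_Schwarz_ineq2)
  also have "\<dots> \<le> norm x * (spectral_norm M * norm y)"
    by (intro mult_left_mono norm_mult_le_spectral_norm norm_ge_zero)
  finally show ?thesis by (simp add: algebra_simps)
qed

text \<open>The spectral norm is the norm of the bilinear form \<open>x\<^sup>T M y\<close>. This description is preferred to the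
operator norm below because it passes through finite sums and integrals of matrices
and treats the left and the right factor of a product \<open>A Z A'\<^sup>T\<close> alike.\<close>

lemma spectral_norm_le:
  fixes M :: "real^'n^'m"
  assumes "\<And>x y. \<bar>x \<bullet> (M *v y)\<bar> \<le> K * (norm x * norm y)"
  shows "spectral_norm M \<le> K"
  unfolding spectral_norm_def
proof (rule onorm_le)
  fix y
  have "norm (M *v y) * norm (M *v y) \<le> norm (M *v y) * (K * norm y)"
    using assms[of "M *v y" y] by (simp add: power2_norm_eq_inner[symmetric] power2_eq_square algebra_simps)
  \<comment> \<open>This sign settles the case \<open>M y = 0\<close>, in which \<open>|M y|\<close> cannot be cancelled.\<close>
  moreover have "0 \<le> K * norm y"
  proof (cases "y = 0")
    case False
    have "0 \<le> K * (norm (axis i 1 :: real^'m) * norm y)" for i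
      using order_trans[OF abs_ge_zero assms] .
    then show ?thesis by simp
  qed simp
  ultimately show "norm (M *v y) \<le> K * norm y"
    by (cases "norm (M *v y) = 0") (auto simp: mult_le_cancel_left)
qed

text \<open>Transposition preserves the spectral norm: \<open>|M\<^sup>T x|\<^sup>2 = x \<bullet> M (M\<^sup>T x)\<close>, and one factor \<open>|M\<^sup>T x|\<close> cancels.\<close>

lemma norm_transpose_mult_le_spectral_norm:
  "norm (transpose M *v x) \<le> spectral_norm (M::real^'n^'m) * norm x"
proof (cases "transpose M *v x = 0")
  case False
  have "norm (transpose M *v x) * norm (transpose M *v x) = x \<bullet> (M *v (transpose M *v x))"
    by (metis dot_lmul_matrix power2_eq_square power2_norm_eq_inner transpose_matrix_vector)
  also have "\<dots> \<le> norm (transpose M *v x) * (spectral_norm M * norm x)"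
    using inner_mult_le_spectral_norm[of x M "transpose M *v x"] by (simp add: algebra_simps)
  finally show ?thesis using False by (simp add: mult_le_cancel_left)
qed (simp add: spectral_norm_nonneg)

text \<open>Contraction is available only in the spectral norm, while summability and integrability refer to
the Frobenius norm. Every entry is a value of the bilinear form at unit vectors, which gives the
comparison.\<close>

lemma norm_le_spectral_norm:
  "norm (M::real^'n^'m) \<le> real CARD('m) * real CARD('n) * spectral_norm M"
proof -
  have entry: "\<bar>M $ i $ j\<bar> \<le> spectral_norm M" for i j
  proof -
    have "axis i 1 \<bullet> (M *v axis j 1) = M $ i $ j"
      by (simp add: inner_axis' matrix_vector_mul_component inner_axis)
    then show ?thesis using inner_mult_le_spectral_norm[of "axis i 1" M "axis j 1"] by simp
  qed
  have row: "norm (M $ i) \<le> real CARD('n) * spectral_norm M" for i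
  proof -
    have "norm (M $ i) \<le> (\<Sum>j\<in>UNIV. \<bar>M $ i $ j\<bar>)" by (rule norm_le_l1_cart)
    also have "\<dots> \<le> real CARD('n) * spectral_norm M" using entry by (intro sum_bounded_above) 
    finally show ?thesis .
  qed
  have "norm M \<le> (\<Sum>i\<in>UNIV. norm (M $ i))" unfolding norm_vec_def by (rule L2_set_le_sum) simp
  also have "\<dots> \<le> real CARD('m) * (real CARD('n) * spectral_norm M)"
    using row by (intro sum_bounded_above)
  finally show ?thesis by (simp add: mult.assoc)
qed

section \<open>The matrix exponential\<close>

lemma mat_exp_sums: "(\<lambda>k. (1 / fact k) *\<^sub>R (((**) A ^^ k) (mat 1))) sums mat_exp (A::real^'n^'n)"
proof -
  interpret bounded_bilinear "(**) :: real^'n^'n \<Rightarrow> real^'n^'n \<Rightarrow> real^'n^'n"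
    by (rule bounded_bilinear_matrix_mult)
  obtain K where K: "0 \<le> K" "\<And>B :: real^'n^'n. norm (A ** B) \<le> norm B * K"
    using bounded_linear.nonneg_bounded[OF bounded_linear_right[of A]] by blast
  have pow: "norm (((**) A ^^ k) (mat 1)) \<le> K ^ k * norm (mat 1 :: real^'n^'n)" for k
  proof (induction k)
    case (Suc k)
    have "norm (((**) A ^^ Suc k) (mat 1)) \<le> norm (((**) A ^^ k) (mat 1)) * K" by (simp add: K)
    also have "\<dots> \<le> K ^ k * norm (mat 1 :: real^'n^'n) * K" using K by (intro mult_right_mono Suc)
    finally show ?case by (simp add: algebra_simps)
  qed simp
  have "summable (\<lambda>k. (1 / fact k) *\<^sub>R (((**) A ^^ k) (mat 1)))"
  proof (rule summable_comparison_test')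
    show "summable (\<lambda>k. (K ^ k /\<^sub>R fact k) * norm (mat 1 :: real^'n^'n))"
      by (intro summable_mult2 summable_exp_generic)
    show "norm ((1 / fact k) *\<^sub>R (((**) A ^^ k) (mat 1)))
        \<le> (K ^ k /\<^sub>R fact k) * norm (mat 1 :: real^'n^'n)" for k
      using pow[of k] by (simp add: field_simps)
  qed
  then show ?thesis unfolding mat_exp_def by (rule summable_sums)
qed

lemma funpow_scaleR_mult:
  "((**) (t *\<^sub>R (A::real^'n^'n)) ^^ k) B = t ^ k *\<^sub>R (((**) A ^^ k) B)"
  by (induction k) (simp_all add: matrix_matrix_mult_def vec_eq_iff sum_distrib_left mult_ac)

text \<open>Entrywise, the exponential is a scalar power series in \<open>t\<close>, so that it can be differentiated termwise.\<close>

lemma mat_exp_entry_sums: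
  "(\<lambda>k. (((**) A ^^ k) (mat 1) $ i $ j / fact k) * t ^ k) sums (mat_exp (t *\<^sub>R (A::real^'n^'n)) $ i $ j)"
proof -
  have "bounded_linear (\<lambda>M::real^'n^'n. M $ i $ j)"
    using bounded_linear_compose[OF bounded_linear_vec_nth[of j] bounded_linear_vec_nth[of i]] .
  from bounded_linear.sums[OF this mat_exp_sums[of "t *\<^sub>R A"]]
  show ?thesis by (simp add: funpow_scaleR_mult mult.commute)
qed

lemma mat_exp_0: "mat_exp (0::real^'n^'n) = mat 1"
proof -
  have "mat_exp (0 *\<^sub>R 0 :: real^'n^'n) $ i $ j = mat 1 $ i $ j" for i j
    using sums_unique[OF mat_exp_entry_sums[of 0 i j 0], symmetric]
    by (subst (asm) powser_zero) simp
  then show ?thesis by (simp add: vec_eq_iff)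
qed

lemma mat_exp_has_vector_derivative:
  "((\<lambda>t. mat_exp (t *\<^sub>R A)) has_vector_derivative A ** mat_exp (t *\<^sub>R A)) (at t)"
  for A :: "real^'n^'n"
proof (rule has_vector_derivative_matrix)
  fix i j
  define c where "c = (\<lambda>i k. ((**) A ^^ k) (mat 1) $ i $ j / fact k)"
  have sm: "(\<lambda>k. c i k * t ^ k) sums (mat_exp (t *\<^sub>R A) $ i $ j)" for i t
    unfolding c_def by (rule mat_exp_entry_sums)
  have eq: "mat_exp (t *\<^sub>R A) $ i $ j = (\<Sum>k. c i k * t ^ k)" for i t
    using sm by (rule sums_unique)
  have diffs: "diffs (c i) k = (\<Sum>l\<in>UNIV. A $ i $ l * c l k)" for k
    by (simp add: diffs_def c_def matrix_matrix_mult_def sum_distrib_left sum_divide_distrib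
        del: of_nat_Suc)
  have "((\<lambda>t. \<Sum>k. c i k * t ^ k) has_real_derivative (\<Sum>k. diffs (c i) k * t ^ k)) (at t)"
    using sm[of i] by (intro termdiffs_strong_converges_everywhere) (auto simp: summable_def)
  moreover have "(\<lambda>k. \<Sum>l\<in>UNIV. A $ i $ l * (c l k * t ^ k)) sums (\<Sum>l\<in>UNIV. A $ i $ l * mat_exp (t *\<^sub>R A) $ l $ j)"
    by (intro sums_sum sums_mult sm)
  then have "(\<Sum>k. diffs (c i) k * t ^ k) = (A ** mat_exp (t *\<^sub>R A)) $ i $ j"
    by (simp add: diffs sum_distrib_right mult.assoc matrix_matrix_mult_def sums_iff)
  ultimately show "((\<lambda>t. mat_exp (t *\<^sub>R A) $ i $ j) has_real_derivative (A ** mat_exp (t *\<^sub>R A)) $ i $ j) (at t)"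
    by (simp add: eq)
qed

section \<open>Integrals over the half-line and bilinear Fubini rules\<close>

lemma has_bochner_integral_exp_halfline:
  assumes "0 < (c::real)"
  shows "has_bochner_integral lborel (\<lambda>s. indicator {0..} s * exp (- c * s)) (1 / c)"
proof (rule has_bochner_integral_nn_integral)
  have "(\<integral>\<^sup>+ s. ennreal (exp (- c * s)) * indicator {0..} s \<partial>lborel) = ennreal (0 - (- exp (- c * 0) / c))"
  proof (rule nn_integral_FTC_atLeast)
    show "((\<lambda>s. - exp (- c * s) / c) has_real_derivative exp (- c * s)) (at s)" for s
      using assms by (auto intro!: derivative_eq_intros)
    have "((\<lambda>s. exp (- c * s)) \<longlongrightarrow> 0) at_top"
      using assms by (intro exp_at_bot[THEN filterlim_compose] filterlim_tendsto_neg_mult_at_bot[OF tendsto_const])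
        (auto intro: filterlim_ident)
    from tendsto_minus[OF this] show "((\<lambda>s. - exp (- c * s) / c) \<longlongrightarrow> 0) at_top"
      by (intro tendsto_divide_zero) simp
  qed auto
  then show "(\<integral>\<^sup>+ s. ennreal (indicator {0..} s * exp (- c * s)) \<partial>lborel) = ennreal (1 / c)"
    by (simp add: ennreal_mult'' mult.commute ennreal_indicator)
qed (use assms in auto)

lemma halfline_integral_derivative:
  fixes F f :: "real \<Rightarrow> 'a::euclidean_space"
  assumes F: "\<And>s. (F has_vector_derivative f s) (at s)"
    and f: "continuous_on UNIV f"
    and int: "set_integrable lborel {0..} f"
    and lim: "(F \<longlongrightarrow> 0) at_top"
  shows "(LINT s:{0..}|lborel. f s) = - F 0"
proof -
  have "set_integrable lborel {0<..} f"
    by (rule set_integrable_subset[OF int]) auto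
  then have "(LBINT s=ereal 0..\<infinity>. f s) = 0 - F 0"
  proof (intro interval_integral_FTC_integrable)
    have "isCont F 0" using F has_vector_derivative_continuous by blast
    then show "((F \<circ> real_of_ereal) \<longlongrightarrow> F 0) (at_right (ereal 0))"
      by (simp add: ereal_tendsto_simps isCont_def filterlim_at_split)
    show "((F \<circ> real_of_ereal) \<longlongrightarrow> 0) (at_left \<infinity>)"
      using lim by (simp add: ereal_tendsto_simps)
    show "isCont f s" for s using f by (simp add: continuous_on_eq_continuous_at)
  qed (use F in \<open>auto simp: einterval_eq_Ici\<close>)
  \<comment> \<open>The interval integral runs over the open half-line; the endpoint is a null set.\<close>
  moreover have "(LINT s:{0..}|lborel. f s) = (LINT s:{0<..}|lborel. f s)"
  proof (rule set_integral_cong_set)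
    show "AE s :: real in lborel. s \<in> {0<..} \<longleftrightarrow> s \<in> {0..}"
      by (rule eventually_mono[OF AE_lborel_singleton[of "0::real"]]) auto
    have "f \<in> borel_measurable borel" using f by (rule borel_measurable_continuous_onI)
    then show "set_borel_measurable lborel {0..} f" "set_borel_measurable lborel {0<..} f"
      unfolding set_borel_measurable_def by auto
  qed
  ultimately show ?thesis by (simp add: interval_integral_to_infinity_eq)
qed

text \<open>Bilinear form of Fubini's theorem for functions that separate the variables. It turns the integral of a
mixed kernel into the form evaluated at two independent integrals.\<close>

lemma pair_integral_bounded_bilinear:
  fixes b :: "'a::{banach,second_countable_topology} \<Rightarrow> 'b::{banach,second_countable_topology} \<Rightarrow> 'c::{banach,second_countable_topology}"
  assumes "bounded_bilinear b" "sigma_finite_measure M1" "sigma_finite_measure M2"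
    and u: "integrable M1 u" and v: "integrable M2 v"
  shows "integrable (M1 \<Otimes>\<^sub>M M2) (\<lambda>p. b (u (fst p)) (v (snd p)))" (is ?int)
    and "(LINT p|(M1 \<Otimes>\<^sub>M M2). b (u (fst p)) (v (snd p))) = b (integral\<^sup>L M1 u) (integral\<^sup>L M2 v)" (is ?eq)
proof -
  interpret bounded_bilinear b by fact
  interpret M1: sigma_finite_measure M1 by fact
  interpret M2: sigma_finite_measure M2 by fact
  interpret pair_sigma_finite M1 M2 ..
  note [measurable] = borel_measurable_integrable[OF u] borel_measurable_integrable[OF v]
  have meas: "(\<lambda>p. b (u (fst p)) (v (snd p))) \<in> borel_measurable (M1 \<Otimes>\<^sub>M M2)"
    by (rule borel_measurable_continuous_Pair[where H = b])
      (measurable, intro bounded_bilinear.continuous_on[OF assms(1)] continuous_intros)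
  obtain K where K: "\<And>x y. norm (b x y) \<le> norm x * norm y * K" using bounded by blast
  have *: "integrable (M1 \<Otimes>\<^sub>M M2) (\<lambda>p. norm (u (fst p)) * norm (v (snd p)) * K)"
  proof (rule Fubini_integrable)
    show "integrable M1 (\<lambda>x. LINT y|M2. norm (norm (u (fst (x, y))) * norm (v (snd (x, y))) * K))"
      using u by (simp add: abs_mult integrable_norm)
    show "AE x in M1. integrable M2 (\<lambda>y. norm (u (fst (x, y))) * norm (v (snd (x, y))) * K)"
      using v by (simp add: integrable_norm)
  qed auto
  show int: ?int
    by (rule Bochner_Integration.integrable_bound[OF * meas], rule AE_I2)
      (simp only: norm_scaleR real_norm_def order_trans[OF K abs_ge_self])
  have "(LINT p|(M1 \<Otimes>\<^sub>M M2). b (u (fst p)) (v (snd p))) = (LINT x|M1. LINT y|M2. b (u x) (v y))"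
    using integral_fst'[OF int] by simp
  also have "\<dots> = (LINT x|M1. b (u x) (integral\<^sup>L M2 v))"
    by (intro Bochner_Integration.integral_cong refl integral_bounded_linear bounded_linear_right v)
  also have "\<dots> = b (integral\<^sup>L M1 u) (integral\<^sup>L M2 v)"
    by (intro integral_bounded_linear bounded_linear_left u)
  finally show ?eq .
qed

lemma infsum_bounded_bilinear:
  fixes b :: "'a::banach \<Rightarrow> 'b::banach \<Rightarrow> 'c::banach"
  assumes "bounded_bilinear b" and u: "(\<lambda>i. norm (u i)) summable_on I" and v: "(\<lambda>j. norm (v j)) summable_on J"
  shows "(\<lambda>(i, j). b (u i) (v j)) summable_on I \<times> J" (is ?sum)
    and "(\<Sum>\<^sub>\<infinity>(i, j)\<in>I \<times> J. b (u i) (v j)) = b (infsum u I) (infsum v J)" (is ?eq)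
proof -
  interpret bounded_bilinear b by fact
  obtain K where K: "\<And>x y. norm (b x y) \<le> norm x * norm y * K" using bounded by blast
  have "(\<lambda>(i, j). norm (u i) * norm (v j)) summable_on I \<times> J"
  proof (rule summable_on_SigmaI)
    show "((\<lambda>j. (\<lambda>(i, j). norm (u i) * norm (v j)) (i, j)) has_sum
        norm (u i) * (\<Sum>\<^sub>\<infinity>j\<in>J. norm (v j))) J" for i
      using has_sum_cmult_right[OF has_sum_infsum[OF v]] by simp
    show "(\<lambda>i. norm (u i) * (\<Sum>\<^sub>\<infinity>j\<in>J. norm (v j))) summable_on I"
      using u by (rule summable_on_cmult_left)
  qed auto
  then have "(\<lambda>p. (\<lambda>(i, j). norm (u i) * norm (v j)) p * K) summable_on I \<times> J"
    by (rule summable_on_cmult_left)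
  then have "(\<lambda>p. norm ((\<lambda>(i, j). b (u i) (v j)) p)) summable_on I \<times> J"
    by (rule summable_on_comparison_test) (auto simp: K)
  then show sum: ?sum by (rule Infinite_Sum.abs_summable_summable)
  have "(\<Sum>\<^sub>\<infinity>(i, j)\<in>I \<times> J. b (u i) (v j)) = (\<Sum>\<^sub>\<infinity>i\<in>I. \<Sum>\<^sub>\<infinity>j\<in>J. b (u i) (v j))"
    using infsum_Sigma'_banach[OF sum] by simp
  also have "\<dots> = (\<Sum>\<^sub>\<infinity>i\<in>I. b (u i) (infsum v J))"
    by (intro infsum_cong infsumI has_sum_bounded_linear[OF bounded_linear_right]
        has_sum_infsum[OF Infinite_Sum.abs_summable_summable[OF v]])
  also have "\<dots> = b (infsum u I) (infsum v J)"
    by (intro infsumI has_sum_bounded_linear[OF bounded_linear_left]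
        has_sum_infsum[OF Infinite_Sum.abs_summable_summable[OF u]])
  finally show ?eq .
qed

section \<open>Sylvester operators and two-sided matrix flows\<close>

text \<open>The solution of \<open>Z' = A Z + Z A'\<^sup>T\<close> with initial value \<open>Z\<close>.\<close>

definition flow :: "real^'n^'n \<Rightarrow> real^'r^'r \<Rightarrow> real \<Rightarrow> real^'r^'n \<Rightarrow> real^'r^'n" where
  "flow A A' s Z = mat_exp (s *\<^sub>R A) ** Z ** transpose (mat_exp (s *\<^sub>R A'))"

definition sylvester :: "real^'n^'n \<Rightarrow> real^'r^'r \<Rightarrow> real^'r^'n \<Rightarrow> real^'r^'n" where
  "sylvester A A' Z = A ** Z + Z ** transpose A'"

definition coupling :: "('m::finite \<Rightarrow> real^'n^'n) \<Rightarrow> ('m \<Rightarrow> real^'r^'r) \<Rightarrow> real^'r^'n \<Rightarrow> real^'r^'n" where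
  "coupling N N' Z = (\<Sum>k\<in>UNIV. N k ** Z ** transpose (N' k))"

text \<open>For decaying flows this is the solution \<open>W\<close> of the Sylvester equation \<open>A W + W A'\<^sup>T = - Z\<close>.\<close>

definition flow_integral :: "real^'n^'n \<Rightarrow> real^'r^'r \<Rightarrow> real^'r^'n \<Rightarrow> real^'r^'n" where
  "flow_integral A A' Z = (LINT s:{0..}|lborel. flow A A' s Z)"

lemma bounded_linear_sandwich: "bounded_linear (\<lambda>Z::real^'r^'n. A ** Z ** B)"
  by (intro bounded_linear_compose[OF bounded_bilinear.bounded_linear_left[OF bounded_bilinear_matrix_mult]]
      bounded_bilinear.bounded_linear_right[OF bounded_bilinear_matrix_mult])

lemma bounded_linear_flow: "bounded_linear (flow A A' s)"
  unfolding flow_def by (rule bounded_linear_sandwich)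

lemma bounded_linear_coupling: "bounded_linear (coupling N N')"
  unfolding coupling_def by (intro bounded_linear_sum bounded_linear_sandwich)

lemma bounded_linear_sylvester: "bounded_linear (sylvester A A')"
  unfolding sylvester_def
  by (intro bounded_linear_add bounded_bilinear.bounded_linear_left[OF bounded_bilinear_matrix_mult]
      bounded_bilinear.bounded_linear_right[OF bounded_bilinear_matrix_mult])

lemma continuous_mat_exp: "continuous_on UNIV (\<lambda>s. mat_exp (s *\<^sub>R A))"
  by (intro continuous_at_imp_continuous_on ballI
      has_vector_derivative_continuous[OF mat_exp_has_vector_derivative])

lemma continuous_flow: "continuous_on UNIV (\<lambda>p. flow A A' (fst p) (snd p))"
  unfolding flow_def
  by (intro bounded_bilinear.continuous_on[OF bounded_bilinear_matrix_mult]
      bounded_linear.continuous_on[OF bounded_linear_transpose]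
      continuous_on_compose2[OF continuous_mat_exp] continuous_intros) auto

lemma flow_has_vector_derivative:
  "((\<lambda>s. flow A A' s Z) has_vector_derivative sylvester A A' (flow A A' s Z)) (at s)"
proof -
  have "((\<lambda>s. mat_exp (s *\<^sub>R A) ** Z) has_vector_derivative (A ** mat_exp (s *\<^sub>R A)) ** Z) (at s)"
    by (intro bounded_linear.has_vector_derivative[OF
        bounded_bilinear.bounded_linear_left[OF bounded_bilinear_matrix_mult]] mat_exp_has_vector_derivative)
  moreover have "((\<lambda>s. transpose (mat_exp (s *\<^sub>R A'))) has_vector_derivative transpose (A' ** mat_exp (s *\<^sub>R A'))) (at s)"
    by (intro bounded_linear.has_vector_derivative[OF bounded_linear_transpose] mat_exp_has_vector_derivative)
  ultimately have "((\<lambda>s. flow A A' s Z) has_vector_derivative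
      (mat_exp (s *\<^sub>R A) ** Z) ** transpose (A' ** mat_exp (s *\<^sub>R A'))
      + ((A ** mat_exp (s *\<^sub>R A)) ** Z) ** transpose (mat_exp (s *\<^sub>R A'))) (at s)"
    unfolding flow_def by (rule bounded_bilinear.has_vector_derivative[OF bounded_bilinear_matrix_mult])
  then show ?thesis
    by (simp add: sylvester_def flow_def matrix_transpose_mul matrix_mul_assoc add.commute)
qed

lemma flow_0: "flow A A' 0 Z = Z"
  by (simp add: flow_def mat_exp_0)

text \<open>The block row applied from the left collects all \<open>N\<^sub>k\<^sup>T x\<close> in one vector. With Cauchy--Schwarz this is what
bounds the coupling term by the norm of the whole block row instead of by a sum over the blocks.\<close>

lemma norm_block_row:
  "(norm (transpose (block_row N) *v x))\<^sup>2 = (\<Sum>k\<in>UNIV. (norm (transpose (N k) *v x))\<^sup>2)"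
  for N :: "'m::finite \<Rightarrow> real^'n^'n"
proof -
  have "(norm (transpose (block_row N) *v x))\<^sup>2
      = (\<Sum>kl\<in>UNIV. (\<Sum>i\<in>UNIV. N (fst kl) $ i $ snd kl * x $ i)\<^sup>2)"
    by (simp add: norm_vec_def L2_set_def sum_nonneg matrix_vector_mult_def transpose_def block_row_def
        del: transpose_matrix_vector)
  also have "\<dots> = (\<Sum>k\<in>UNIV. \<Sum>l\<in>UNIV. (\<Sum>i\<in>UNIV. N k $ i $ l * x $ i)\<^sup>2)"
    by (simp add: sum.cartesian_product case_prod_beta flip: UNIV_Times_UNIV)
  also have "\<dots> = (\<Sum>k\<in>UNIV. (norm (transpose (N k) *v x))\<^sup>2)"
    by (simp add: norm_vec_def L2_set_def sum_nonneg matrix_vector_mult_def transpose_def 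
        del: transpose_matrix_vector)
  finally show ?thesis .
qed

lemma spectral_norm_sandwich:
  "spectral_norm (A ** (Z::real^'r^'n) ** transpose A') \<le> spectral_norm A * spectral_norm A' * spectral_norm Z"
proof (rule spectral_norm_le)
  fix x y
  have "x \<bullet> ((A ** Z ** transpose A') *v y) = (transpose A *v x) \<bullet> (Z *v (transpose A' *v y))"
    by (simp add: dot_lmul_matrix matrix_vector_mul_assoc matrix_mul_assoc del: transpose_matrix_vector)
      (simp add: dot_lmul_matrix matrix_vector_mul_assoc matrix_mul_assoc)
  also have "\<bar>\<dots>\<bar> \<le> spectral_norm Z * (norm (transpose A *v x) * norm (transpose A' *v y))"
    by (rule inner_mult_le_spectral_norm)
  also have "\<dots> \<le> spectral_norm Z * ((spectral_norm A * norm x) * (spectral_norm A' * norm y))"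
    by (intro mult_left_mono mult_mono norm_transpose_mult_le_spectral_norm
        spectral_norm_nonneg mult_nonneg_nonneg norm_ge_zero)
  finally show "\<bar>x \<bullet> ((A ** Z ** transpose A') *v y)\<bar>
    \<le> spectral_norm A * spectral_norm A' * spectral_norm Z * (norm x * norm y)"
    by (simp add: algebra_simps)
qed

lemma spectral_norm_coupling:
  fixes N :: "'m::finite \<Rightarrow> real^'n^'n" and N' :: "'m \<Rightarrow> real^'r^'r"
  shows "spectral_norm (coupling N N' Z)
    \<le> spectral_norm (block_row N) * spectral_norm (block_row N') * spectral_norm Z"
proof (rule spectral_norm_le)
  fix x y
  let ?f = "\<lambda>k. norm (transpose (N k) *v x)" and ?g = "\<lambda>k. norm (transpose (N' k) *v y)"
  have L2: "L2_set ?f UNIV = norm (transpose (block_row N) *v x)"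
    "L2_set ?g UNIV = norm (transpose (block_row N') *v y)"
    by (simp_all add: L2_set_def norm_block_row[symmetric] del: transpose_matrix_vector)
  have "x \<bullet> (coupling N N' Z *v y) = (\<Sum>k\<in>UNIV. (transpose (N k) *v x) \<bullet> (Z *v (transpose (N' k) *v y)))"
  proof -
    have "coupling N N' Z *v y = (\<Sum>k\<in>UNIV. (N k ** Z ** transpose (N' k)) *v y)"
      unfolding coupling_def by (induction rule: infinite_finite_induct) (auto simp: matrix_vector_mult_add_rdistrib)
    then show ?thesis
      by (simp add: inner_sum_right dot_lmul_matrix matrix_vector_mul_assoc matrix_mul_assoc
          del: transpose_matrix_vector)
         (simp add: dot_lmul_matrix matrix_vector_mul_assoc matrix_mul_assoc)
  qed
  also have "\<bar>\<dots>\<bar> \<le> (\<Sum>k\<in>UNIV. spectral_norm Z * (?f k * ?g k))"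
    by (intro order_trans[OF sum_abs] sum_mono inner_mult_le_spectral_norm)
  also have "\<dots> = spectral_norm Z * (\<Sum>k\<in>UNIV. \<bar>?f k\<bar> * \<bar>?g k\<bar>)"
    by (simp add: sum_distrib_left)
  also have "\<dots> \<le> spectral_norm Z * (L2_set ?f UNIV * L2_set ?g UNIV)"
    by (intro mult_left_mono L2_set_mult_ineq spectral_norm_nonneg)
  also have "\<dots> \<le> spectral_norm Z * ((spectral_norm (block_row N) * norm x) * (spectral_norm (block_row N') * norm y))"
    unfolding L2 by (intro mult_left_mono mult_mono norm_transpose_mult_le_spectral_norm
        spectral_norm_nonneg mult_nonneg_nonneg norm_ge_zero)
  finally show "\<bar>x \<bullet> (coupling N N' Z *v y)\<bar>
    \<le> spectral_norm (block_row N) * spectral_norm (block_row N') * spectral_norm Z * (norm x * norm y)"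
    by (simp add: algebra_simps)
qed

section \<open>The generalized Lyapunov equation\<close>

text \<open>Both halves of the result are instances of the same theory for two systems, the second one with both
systems equal. The locale fixes the pair with the decay and smallness conditions. The letters
\<open>\<Phi>\<close>, \<open>\<L>\<close>, \<open>\<N>\<close> abbreviate its flow, Sylvester operator and coupling, and \<open>\<T> Z\<close> is
the integral of \<open>\<Phi> s Z\<close> over \<open>s \<ge> 0\<close>.\<close>

locale bqo_pair =
  fixes S :: "('n::finite, 'm::finite, 'p::finite) bqo"
    and S' :: "('r::finite, 'm, 'p) bqo"
    and \<alpha> \<beta> \<alpha>' \<beta>' :: real
  assumes params: "stability_params (sysA S) \<alpha> \<beta>" and params': "stability_params (sysA S') \<alpha>' \<beta>'"
    and small: "(spectral_norm (calN S))\<^sup>2 < 2 * \<alpha> / \<beta>\<^sup>2"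
    and small': "(spectral_norm (calN S'))\<^sup>2 < 2 * \<alpha>' / \<beta>'\<^sup>2"
begin

abbreviation "\<Phi> \<equiv> flow (sysA S) (sysA S')"
abbreviation "\<T> \<equiv> flow_integral (sysA S) (sysA S')"
abbreviation "\<L> \<equiv> sylvester (sysA S) (sysA S')"
abbreviation "\<N> \<equiv> coupling (sysN S) (sysN S')"

lemma pos: "0 < \<alpha>" "0 < \<alpha>'" "0 < \<beta>" "0 < \<beta>'"
  using params params' by (auto simp: stability_params_def)

lemma spectral_norm_flow:
  assumes "0 \<le> s"
  shows "spectral_norm (\<Phi> s Z) \<le> \<beta> * \<beta>' * exp (- (\<alpha> + \<alpha>') * s) * spectral_norm Z"
proof -
  have "spectral_norm (\<Phi> s Z)
      \<le> spectral_norm (mat_exp (s *\<^sub>R sysA S)) * spectral_norm (mat_exp (s *\<^sub>R sysA S')) * spectral_norm Z"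
    unfolding flow_def by (rule spectral_norm_sandwich)
  also have "\<dots> \<le> (\<beta> * exp (- \<alpha> * s)) * (\<beta>' * exp (- \<alpha>' * s)) * spectral_norm Z"
    using params params' assms pos
    by (intro mult_right_mono mult_mono spectral_norm_nonneg) (auto simp: stability_params_def)
  also have "exp (- \<alpha> * s) * exp (- \<alpha>' * s) = exp (- (\<alpha> + \<alpha>') * s)"
    by (simp add: algebra_simps flip: exp_add)
  then have "(\<beta> * exp (- \<alpha> * s)) * (\<beta>' * exp (- \<alpha>' * s)) = \<beta> * \<beta>' * exp (- (\<alpha> + \<alpha>') * s)"
    by (metis mult.assoc mult.left_commute)
  finally show ?thesis .
qed

lemma norm_flow:
  obtains c where "0 \<le> c" "\<And>s Z. 0 \<le> s \<Longrightarrow> norm (\<Phi> s Z) \<le> c * spectral_norm Z * exp (- (\<alpha> + \<alpha>') * s)"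
proof
  fix s :: real and Z assume "0 \<le> s"
  have "norm (\<Phi> s Z) \<le> real CARD('n) * real CARD('r) * spectral_norm (\<Phi> s Z)" by (rule norm_le_spectral_norm)
  also have "\<dots> \<le> real CARD('n) * real CARD('r) * (\<beta> * \<beta>' * exp (- (\<alpha> + \<alpha>') * s) * spectral_norm Z)"
    using \<open>0 \<le> s\<close> by (intro mult_left_mono spectral_norm_flow) auto
  finally show "norm (\<Phi> s Z) \<le> (real CARD('n) * real CARD('r) * \<beta> * \<beta>') * spectral_norm Z * exp (- (\<alpha> + \<alpha>') * s)"
    by (simp add: algebra_simps)
qed (use pos in auto)

lemma flow_measurable [measurable (raw)]:
  assumes "f \<in> borel_measurable M" "g \<in> borel_measurable M"
  shows "(\<lambda>x. \<Phi> (f x) (g x)) \<in> borel_measurable M"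
  using assms continuous_flow by (rule borel_measurable_continuous_Pair)

lemma flow_integrable: "set_integrable lborel {0..} (\<lambda>s. \<Phi> s Z)"
proof -
  obtain c where c: "\<And>s. 0 \<le> s \<Longrightarrow> norm (\<Phi> s Z) \<le> c * spectral_norm Z * exp (- (\<alpha> + \<alpha>') * s)"
    using norm_flow by metis
  have "integrable lborel (\<lambda>s. (c * spectral_norm Z) * (indicator {0..} s * exp (- (\<alpha> + \<alpha>') * s)))"
    using has_bochner_integral_exp_halfline[of "\<alpha> + \<alpha>'"] pos
    by (intro integrable_mult_right) (auto simp: has_bochner_integral_iff)
  then show ?thesis unfolding set_integrable_def
  proof (rule Bochner_Integration.integrable_bound)
    show "AE s in lborel. norm (indicator {0..} s *\<^sub>R \<Phi> s Z)
        \<le> norm ((c * spectral_norm Z) * (indicator {0..} s * exp (- (\<alpha> + \<alpha>') * s)))"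
    proof (rule AE_I2)
      fix s
      show "norm (indicator {0..} s *\<^sub>R \<Phi> s Z)
        \<le> norm ((c * spectral_norm Z) * (indicator {0..} s * exp (- (\<alpha> + \<alpha>') * s)))"
        using order_trans[OF c[of s] abs_ge_self] by (simp split: split_indicator)
    qed
  qed measurable
qed

lemma linear_flow_integral: "linear \<T>"
proof (rule linearI)
  note lin = bounded_linear.linear[OF bounded_linear_flow]
  show "\<T> (Y + Z) = \<T> Y + \<T> Z" for Y Z
    unfolding flow_integral_def linear_add[OF lin] by (intro set_integral_add flow_integrable)
  show "\<T> (a *\<^sub>R Z) = a *\<^sub>R \<T> Z" for a Z
    unfolding flow_integral_def linear_scale[OF lin] by (rule set_integral_scaleR_right)
qed

text \<open>The bound is obtained for the scalar integrand \<open>x \<bullet> \<Phi> s Z y\<close>, whose integral over the exponential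
majorant produces the factor \<open>1 / (\<alpha> + \<alpha>')\<close>.\<close>

lemma spectral_norm_flow_integral:
  "spectral_norm (\<T> Z) \<le> \<beta> * \<beta>' / (\<alpha> + \<alpha>') * spectral_norm Z"
proof (rule spectral_norm_le)
  fix x :: "real^'n" and y :: "real^'r"
  let ?e = "\<lambda>s. indicator {0..} s * exp (- (\<alpha> + \<alpha>') * s)"
  let ?K = "\<beta> * \<beta>' * spectral_norm Z * (norm x * norm y)"
  have e: "integrable lborel ?e" "integral\<^sup>L lborel ?e = 1 / (\<alpha> + \<alpha>')"
    using has_bochner_integral_exp_halfline[of "\<alpha> + \<alpha>'"] pos by (auto simp: has_bochner_integral_iff)
  have "linear (\<lambda>M::real^'r^'n. x \<bullet> (M *v y))"
    by (intro linearI) (simp_all add: matrix_vector_mult_add_rdistrib inner_add_right flip: scaleR_matrix_vector_assoc)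
  then have bl: "bounded_linear (\<lambda>M::real^'r^'n. x \<bullet> (M *v y))"
    by (simp add: linear_conv_bounded_linear)
  have int: "integrable lborel (\<lambda>s. indicator {0..} s *\<^sub>R \<Phi> s Z)"
    using flow_integrable by (simp add: set_integrable_def)
  have "\<bar>x \<bullet> (\<T> Z *v y)\<bar> = norm (LINT s|lborel. x \<bullet> ((indicator {0..} s *\<^sub>R \<Phi> s Z) *v y))"
    unfolding flow_integral_def set_lebesgue_integral_def integral_bounded_linear[OF bl int] by simp
  also have "\<dots> \<le> (LINT s|lborel. ?K * ?e s)"
  proof (rule Bochner_Integration.integral_norm_bound_integral)
    show "integrable lborel (\<lambda>s. x \<bullet> ((indicator {0..} s *\<^sub>R \<Phi> s Z) *v y))"
      by (rule integrable_bounded_linear[OF bl int])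
    show "integrable lborel (\<lambda>s. ?K * ?e s)" by (intro integrable_mult_right e)
    fix s
    show "norm (x \<bullet> ((indicator {0..} s *\<^sub>R \<Phi> s Z) *v y)) \<le> ?K * ?e s"
    proof (cases "0 \<le> s")
      case True
      have "\<bar>x \<bullet> (\<Phi> s Z *v y)\<bar> \<le> spectral_norm (\<Phi> s Z) * (norm x * norm y)"
        by (rule inner_mult_le_spectral_norm)
      also have "\<dots> \<le> (\<beta> * \<beta>' * exp (- (\<alpha> + \<alpha>') * s) * spectral_norm Z) * (norm x * norm y)"
        using True by (intro mult_right_mono spectral_norm_flow) auto
      finally show ?thesis using True by (simp add: algebra_simps)
    qed simp
  qed
  also have "\<dots> = ?K * (1 / (\<alpha> + \<alpha>'))"
    by (simp only: integral_mult_right_zero e)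
  finally show "\<bar>x \<bullet> (\<T> Z *v y)\<bar> \<le> \<beta> * \<beta>' / (\<alpha> + \<alpha>') * spectral_norm Z * (norm x * norm y)"
    by (simp add: algebra_simps)
qed

lemma flow_tendsto_0: "((\<lambda>s. \<Phi> s Z) \<longlongrightarrow> 0) at_top"
proof -
  obtain c where c: "\<And>s. 0 \<le> s \<Longrightarrow> norm (\<Phi> s Z) \<le> c * spectral_norm Z * exp (- (\<alpha> + \<alpha>') * s)"
    using norm_flow by metis
  have "((\<lambda>s. exp (- (\<alpha> + \<alpha>') * s)) \<longlongrightarrow> 0) at_top"
    using pos by (intro exp_at_bot[THEN filterlim_compose] filterlim_tendsto_neg_mult_at_bot[OF tendsto_const])
      (auto intro: filterlim_ident)
  then have "((\<lambda>s. c * spectral_norm Z * exp (- (\<alpha> + \<alpha>') * s)) \<longlongrightarrow> 0) at_top"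
    by (intro tendsto_mult_right_zero)
  then show ?thesis
    by (rule Lim_null_comparison[rotated]) (rule eventually_mono[OF eventually_ge_at_top[of 0]], rule c)
qed

text \<open>The Sylvester operator maps the flow to its derivative, so the integral of the image telescopes to minus
the initial value.\<close>

lemma sylvester_flow_integral: "\<L> (\<T> Z) = - Z"
proof -
  note syl = bounded_linear_sylvester[of "sysA S" "sysA S'"]
  have int: "integrable lborel (\<lambda>s. indicator {0..} s *\<^sub>R \<Phi> s Z)"
    using flow_integrable by (simp add: set_integrable_def)
  have eq: "\<L> (indicator {0..} s *\<^sub>R \<Phi> s Z) = indicator {0..} s *\<^sub>R \<L> (\<Phi> s Z)" for s
    by (rule linear_scale[OF bounded_linear.linear[OF syl]])
  have "\<L> (\<T> Z) = (LINT s:{0..}|lborel. \<L> (\<Phi> s Z))"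
    unfolding flow_integral_def set_lebesgue_integral_def
      integral_bounded_linear[OF syl int, symmetric] eq ..
  also have "\<dots> = - \<Phi> 0 Z"
  proof (rule halfline_integral_derivative[OF flow_has_vector_derivative])
    show "set_integrable lborel {0..} (\<lambda>s. \<L> (\<Phi> s Z))"
      using integrable_bounded_linear[OF syl int] by (simp add: set_integrable_def eq)
    show "continuous_on UNIV (\<lambda>s. \<L> (\<Phi> s Z))"
      by (intro bounded_linear.continuous_on[OF syl] continuous_on_compose2[OF continuous_flow,
            where f = "\<lambda>s. (s, Z)", simplified] continuous_intros)
  qed (rule flow_tendsto_0)
  finally show ?thesis by (simp add: flow_0)
qed

text \<open>A linear right inverse on a finite-dimensional space is also a left inverse.\<close>

lemma flow_integral_sylvester: "\<T> (\<L> Z) = - Z"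
proof -
  have "linear (\<lambda>Z. - \<T> Z)" "linear \<L>"
    using linear_flow_integral bounded_linear.linear[OF bounded_linear_sylvester]
    by (auto intro: linear_compose_neg)
  moreover have "\<L> \<circ> (\<lambda>Z. - \<T> Z) = id"
    by (auto simp: fun_eq_iff linear_neg[OF bounded_linear.linear[OF bounded_linear_sylvester]] sylvester_flow_integral)
  ultimately have "(\<lambda>Z. - \<T> Z) \<circ> \<L> = id"
    by (simp only: linear_inverse_left)
  then have "- \<T> (\<L> Z) = Z" by (simp add: fun_eq_iff)
  then show ?thesis by (simp add: minus_equation_iff)
qed

definition contraction_factor :: real (\<open>\<rho>\<close>) where
  "\<rho> = \<beta> * \<beta>' * (spectral_norm (calN S) * spectral_norm (calN S')) / (\<alpha> + \<alpha>')"

text \<open>The two smallness conditions bound the products \<open>a\<close>, \<open>b\<close> of \<open>\<beta>\<close>, \<open>\<beta>'\<close> with the norms of the block rows by \<open>a\<^sup>2 < 2 \<alpha>\<close> and \<open>b\<^sup>2 < 2 \<alpha>'\<close>.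
The arithmetic-geometric mean inequality combines them to \<open>a b < \<alpha> + \<alpha>'\<close>.\<close>

lemma contraction_factor: "0 \<le> \<rho>" "\<rho> < 1"
proof -
  show "0 \<le> \<rho>" unfolding contraction_factor_def using pos
    by (intro divide_nonneg_pos mult_nonneg_nonneg spectral_norm_nonneg) auto
  define a b where "a = \<beta> * spectral_norm (calN S)" and "b = \<beta>' * spectral_norm (calN S')"
  have "a\<^sup>2 < 2 * \<alpha>" "b\<^sup>2 < 2 * \<alpha>'"
    using small small' pos by (auto simp: a_def b_def power_mult_distrib field_simps)
  moreover have "2 * (a * b) \<le> a\<^sup>2 + b\<^sup>2" by (rule order_trans[OF _ sum_squares_bound]) simp
  ultimately have "a * b < \<alpha> + \<alpha>'" by linarith
  then show "\<rho> < 1" using pos by (simp add: contraction_factor_def a_def b_def field_simps)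
qed

lemma spectral_norm_contraction: "spectral_norm (\<T> (\<N> Z)) \<le> \<rho> * spectral_norm Z"
proof -
  have "spectral_norm (\<T> (\<N> Z)) \<le> \<beta> * \<beta>' / (\<alpha> + \<alpha>') * spectral_norm (\<N> Z)"
    by (rule spectral_norm_flow_integral)
  also have "\<dots> \<le> \<beta> * \<beta>' / (\<alpha> + \<alpha>') * (spectral_norm (calN S) * spectral_norm (calN S') * spectral_norm Z)"
    unfolding calN_def using pos by (intro mult_left_mono spectral_norm_coupling) auto
  finally show ?thesis by (simp add: contraction_factor_def field_simps)
qed

definition lyapunov :: "real^'r^'n \<Rightarrow> real^'r^'n" where
  "lyapunov Z = \<L> Z + \<N> Z"

text \<open>The adjoint of \<open>lyapunov\<close> for the Frobenius inner product; it is the operator of the equation for \<open>Y\<close>.\<close>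

definition lyapunov_adjoint :: "real^'r^'n \<Rightarrow> real^'r^'n" where
  "lyapunov_adjoint Y = transpose (sysA S) ** Y + Y ** sysA S'
     + (\<Sum>k\<in>UNIV. transpose (sysN S k) ** Y ** sysN S' k)"

lemma linear_lyapunov: "linear lyapunov"
  unfolding lyapunov_def
  by (intro linear_compose_add bounded_linear.linear bounded_linear_sylvester bounded_linear_coupling)

lemma linear_lyapunov_adjoint: "linear lyapunov_adjoint"
  unfolding lyapunov_adjoint_def
  by (intro linear_compose_add linear_compose_sum ballI bounded_linear.linear bounded_linear_sandwich
      bounded_bilinear.bounded_linear_left[OF bounded_bilinear_matrix_mult]
      bounded_bilinear.bounded_linear_right[OF bounded_bilinear_matrix_mult])

lemma inner_lyapunov: "lyapunov X \<bullet> Y = X \<bullet> lyapunov_adjoint Y"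
proof -
  have "(A ** X ** transpose B) \<bullet> Y = X \<bullet> (transpose A ** Y ** B)" for A B
    by (simp only: inner_matrix_mult_right[of "A ** X"] inner_matrix_mult_left[of A X]
        transpose_transpose matrix_mul_assoc)
  moreover have "(X ** transpose (sysA S')) \<bullet> Y = X \<bullet> (Y ** sysA S')"
    by (simp only: inner_matrix_mult_right transpose_transpose)
  ultimately show ?thesis
    by (simp add: lyapunov_def lyapunov_adjoint_def sylvester_def coupling_def inner_add_left inner_add_right
      inner_sum_left inner_sum_right inner_matrix_mult_left[of "sysA S"])
qed

text \<open>A solution of the homogeneous equation is a fixed point of the contraction \<open>\<T> \<circ> \<N>\<close>.\<close>

lemma inj_lyapunov: "inj lyapunov"
proof (rule linear_injective_0[OF linear_lyapunov, THEN iffD2], intro allI impI)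
  fix Z assume "lyapunov Z = 0"
  then have "\<N> Z = - \<L> Z" by (simp add: lyapunov_def eq_neg_iff_add_eq_0 add.commute)
  then have "\<T> (\<N> Z) = Z"
    by (simp add: linear_neg[OF linear_flow_integral] flow_integral_sylvester)
  then have "spectral_norm Z \<le> \<rho> * spectral_norm Z"
    using spectral_norm_contraction[of Z] by simp
  then have "spectral_norm Z = 0"
    using mult_strict_right_mono[OF contraction_factor(2), of "spectral_norm Z"] spectral_norm_nonneg[of Z]
    by linarith
  then show "Z = 0" using norm_le_spectral_norm[of Z] by simp
qed

text \<open>The adjoint inherits injectivity because \<open>lyapunov\<close> is onto: if \<open>lyapunov_adjoint Y = 0\<close>, then \<open>Y\<close> is
orthogonal to every \<open>lyapunov X\<close>, hence to itself.\<close>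

lemma bij_lyapunov_adjoint: "bij lyapunov_adjoint"
proof -
  have "inj lyapunov_adjoint"
  proof (rule linear_injective_0[OF linear_lyapunov_adjoint, THEN iffD2], intro allI impI)
    fix Y assume Y: "lyapunov_adjoint Y = 0"
    obtain X where "lyapunov X = Y"
      using linear_injective_imp_surjective[OF linear_lyapunov inj_lyapunov] by (metis surjD)
    with inner_lyapunov[of X Y] Y show "Y = 0" by simp
  qed
  then show ?thesis
    by (simp add: bij_def linear_injective_imp_surjective[OF linear_lyapunov_adjoint])
qed

text \<open>The Neumann series for the solution of \<open>X = \<T> (\<N> X + B B'\<^sup>T)\<close>. Its term with index \<open>i\<close>
will turn out to be the integral of \<open>P\<^sub>i\<^sub>+\<^sub>1 P'\<^sub>i\<^sub>+\<^sub>1\<^sup>T\<close> for the reachability mappings \<open>P\<close>, \<open>P'\<close>.\<close>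

primrec gramian_term :: "nat \<Rightarrow> real^'r^'n" where
  "gramian_term 0 = \<T> (sysB S ** transpose (sysB S'))"
| "gramian_term (Suc i) = \<T> (\<N> (gramian_term i))"

definition gramian :: "real^'r^'n" where
  "gramian = (\<Sum>i. gramian_term i)"

lemma summable_norm_gramian_term: "summable (\<lambda>i. norm (gramian_term i))"
proof (rule summable_comparison_test')
  have geo: "spectral_norm (gramian_term i) \<le> \<rho> ^ i * spectral_norm (gramian_term 0)" for i
  proof (induction i)
    case (Suc i)
    have "spectral_norm (gramian_term (Suc i)) \<le> \<rho> * spectral_norm (gramian_term i)"
      using spectral_norm_contraction by simp
    also have "\<dots> \<le> \<rho> * (\<rho> ^ i * spectral_norm (gramian_term 0))"
      by (intro mult_left_mono Suc contraction_factor)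
    finally show ?case by (simp add: mult.assoc)
  qed simp
  show "summable (\<lambda>i. real CARD('n) * real CARD('r) * (\<rho> ^ i * spectral_norm (gramian_term 0)))"
    using contraction_factor by (intro summable_mult summable_mult2 summable_geometric) simp
  show "norm (norm (gramian_term i)) \<le> real CARD('n) * real CARD('r) * (\<rho> ^ i * spectral_norm (gramian_term 0))" for i
    using order_trans[OF norm_le_spectral_norm mult_left_mono[OF geo]] by simp
qed

lemma gramian_sums: "gramian_term sums gramian"
  unfolding gramian_def by (rule summable_sums[OF summable_norm_cancel[OF summable_norm_gramian_term]])

lemma lyapunov_gramian: "lyapunov gramian = - (sysB S ** transpose (sysB S'))"
proof -
  note N = bounded_linear.sums[OF bounded_linear_coupling gramian_sums]
  have "(\<lambda>i. \<L> (gramian_term (Suc i))) sums (\<L> gramian - \<L> (gramian_term 0))"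
    using bounded_linear.sums[OF bounded_linear_sylvester gramian_sums] by (subst sums_Suc_iff) simp
  moreover have "(\<lambda>i. \<L> (gramian_term (Suc i))) sums (- \<N> gramian)"
    using sums_minus[OF N] by (simp add: sylvester_flow_integral)
  ultimately have "\<L> gramian - \<L> (gramian_term 0) = - \<N> gramian" by (rule sums_unique2)
  then show ?thesis
    by (simp add: lyapunov_def sylvester_flow_integral eq_neg_iff_add_eq_0 add_ac)
qed

end

section \<open>Gram matrices of the reachability mappings\<close>

lemma words_0: "words 0 = {[]}"
  by (auto simp: words_def)

lemma sum_words_Suc: "(\<Sum>w\<in>words (Suc i). f w) = (\<Sum>k\<in>UNIV. \<Sum>w\<in>words i. f (k # w))"
  for f :: "'m::finite list \<Rightarrow> 'a::comm_monoid_add"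
proof -
  have "words (Suc i) = (\<lambda>(k, w). k # w) ` (UNIV \<times> (words i :: 'm list set))"
    by (auto simp: words_def length_Suc_conv image_iff)
  moreover have "inj_on (\<lambda>(k, w). k # w) (UNIV \<times> (words i :: 'm list set))"
    by (auto simp: inj_on_def)
  ultimately have "(\<Sum>w\<in>words (Suc i). f w) = (\<Sum>(k, w)\<in>UNIV \<times> words i. f (k # w))"
    by (simp add: sum.reindex case_prod_unfold)
  then show ?thesis by (simp add: sum.cartesian_product)
qed

lemma mult_transpose_cols_mult:
  "mult_transpose_cols W (\<lambda>c. A *v F c) (\<lambda>c. A' *v F' c) = A ** mult_transpose_cols W F F' ** transpose A'"
proof -
  have "mult_transpose_cols W (\<lambda>c. A *v F c) (\<lambda>c. A' *v F' c) $ a $ b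
      = (A ** mult_transpose_cols W F F' ** transpose A') $ a $ b" for a b
  proof -
    have "mult_transpose_cols W (\<lambda>c. A *v F c) (\<lambda>c. A' *v F' c) $ a $ b
        = (\<Sum>c\<in>W. \<Sum>i\<in>UNIV. \<Sum>j\<in>UNIV. A $ a $ i * F c $ i * (A' $ b $ j * F' c $ j))"
      by (simp add: mult_transpose_cols_def matrix_vector_mult_def sum_product)
    also have "\<dots> = (\<Sum>i\<in>UNIV. \<Sum>j\<in>UNIV. \<Sum>c\<in>W. A $ a $ i * F c $ i * (A' $ b $ j * F' c $ j))"
      by (subst sum.swap, intro sum.cong refl sum.swap)
    also have "\<dots> = (\<Sum>j\<in>UNIV. \<Sum>i\<in>UNIV. \<Sum>c\<in>W. A $ a $ i * F c $ i * (A' $ b $ j * F' c $ j))"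
      by (rule sum.swap)
    also have "\<dots> = (A ** mult_transpose_cols W F F' ** transpose A') $ a $ b"
      by (simp add: mult_transpose_cols_def matrix_matrix_mult_def transpose_def sum_distrib_left
          sum_distrib_right mult_ac)
    finally show ?thesis .
  qed
  then show ?thesis by (simp add: vec_eq_iff)
qed

lemma mult_transpose_cols_words_Suc:
  "mult_transpose_cols (words (Suc i)) F G
     = (\<Sum>k\<in>UNIV. mult_transpose_cols (words i) (\<lambda>w. F (k # w)) (\<lambda>w. G (k # w)))"
  for F :: "'m::finite list \<Rightarrow> real^'q"
  by (simp add: mult_transpose_cols_def vec_eq_iff sum_words_Suc)

text \<open>The trace for the mixed kernels has the form on the right, with one word index for each of the two reachability
mappings. The left side shows it as a function of the two Gram matrices.\<close>

lemma inner_mult_transpose_cols: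
  "mult_transpose_cols W F F' \<bullet> mult_transpose_cols V G G'
     = (\<Sum>c\<in>W. \<Sum>d\<in>V. (F c \<bullet> G d) * (F' c \<bullet> G' d))"
proof -
  have "mult_transpose_cols W F F' \<bullet> mult_transpose_cols V G G'
      = (\<Sum>a\<in>UNIV. \<Sum>b\<in>UNIV. \<Sum>c\<in>W. \<Sum>d\<in>V. F c $ a * F' c $ b * (G d $ a * G' d $ b))"
    by (simp add: mult_transpose_cols_def inner_vec_def sum_product)
  also have "\<dots> = (\<Sum>a\<in>UNIV. \<Sum>c\<in>W. \<Sum>b\<in>UNIV. \<Sum>d\<in>V. F c $ a * F' c $ b * (G d $ a * G' d $ b))"
    by (intro sum.cong refl sum.swap)
  also have "\<dots> = (\<Sum>c\<in>W. \<Sum>a\<in>UNIV. \<Sum>b\<in>UNIV. \<Sum>d\<in>V. F c $ a * F' c $ b * (G d $ a * G' d $ b))"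
    by (rule sum.swap)
  also have "\<dots> = (\<Sum>c\<in>W. \<Sum>a\<in>UNIV. \<Sum>d\<in>V. \<Sum>b\<in>UNIV. F c $ a * F' c $ b * (G d $ a * G' d $ b))"
    by (intro sum.cong refl sum.swap)
  also have "\<dots> = (\<Sum>c\<in>W. \<Sum>d\<in>V. \<Sum>a\<in>UNIV. \<Sum>b\<in>UNIV. F c $ a * F' c $ b * (G d $ a * G' d $ b))"
    by (intro sum.cong refl sum.swap)
  also have "\<dots> = (\<Sum>c\<in>W. \<Sum>d\<in>V. (F c \<bullet> G d) * (F' c \<bullet> G' d))"
    by (simp only: inner_vec_def inner_real_def sum_product) (simp only: mult_ac)
  finally show ?thesis .
qed

text \<open>The block row times a Kronecker column \<open>e\<^sub>k \<otimes> x\<close> selects \<open>N\<^sub>k x\<close>.\<close>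

lemma reach_Cons:
  "reach S (Suc (Suc i)) t (k # w)
     = mat_exp (t (Suc (Suc i)) *\<^sub>R sysA S) *v (sysN S k *v reach S (Suc i) t w)"
proof -
  have "calN S *v kron_cols id_cols F (k, w) = sysN S k *v F w" for F
  proof -
    have "(calN S *v kron_cols id_cols F (k, w)) $ a = (sysN S k *v F w) $ a" for a
    proof -
      have "(calN S *v kron_cols id_cols F (k, w)) $ a
          = (\<Sum>(l, b)\<in>UNIV \<times> UNIV. sysN S l $ a $ b * ((if l = k then 1 else 0) * F w $ b))"
        by (simp add: calN_def block_row_def kron_cols_def id_cols_def column_def mat_def
            matrix_vector_mult_def case_prod_unfold)
      also have "\<dots> = (\<Sum>l\<in>UNIV. \<Sum>b\<in>UNIV. if l = k then sysN S l $ a $ b * F w $ b else 0)"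
        by (subst sum.cartesian_product[symmetric]) (intro sum.cong refl, simp)
      also have "\<dots> = (\<Sum>b\<in>UNIV. sysN S k $ a $ b * F w $ b)"
        by (subst sum.swap) simp
      finally show ?thesis by (simp add: matrix_vector_mult_def)
    qed
    then show ?thesis by (simp add: vec_eq_iff)
  qed
  then show ?thesis by (simp add: mult_cols_def flip: matrix_vector_mul_assoc)
qed

text \<open>The product \<open>P\<^sub>i P'\<^sub>i\<^sup>T\<close> of the reachability mappings, a matrix whose size does not grow with \<open>i\<close>. All
integrands depend on the reachability mappings through these matrices only.\<close>

definition reach_gram ::
  "('n::finite, 'm::finite, 'p::finite) bqo \<Rightarrow> ('r::finite, 'm, 'p) bqo \<Rightarrow> nat
     \<Rightarrow> (nat \<Rightarrow> real) \<Rightarrow> real^'r^'n" where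
  "reach_gram S S' i t = mult_transpose_cols (words i) (reach S i t) (reach S' i t)"

lemma reach_gram_1:
  fixes S :: "('n::finite, 'm::finite, 'p::finite) bqo" and S' :: "('r::finite, 'm, 'p) bqo"
  shows "reach_gram S S' (Suc 0) t = flow (sysA S) (sysA S') (t 1) (sysB S ** transpose (sysB S'))"
proof -
  have col: "column k (E ** B) = E *v column k B" for k and E :: "real^'x^'x" and B :: "real^'y^'x"
    by (simp add: column_def matrix_matrix_mult_def matrix_vector_mult_def vec_eq_iff)
  have "(\<Sum>k\<in>UNIV. mult_transpose_cols {[] :: 'm list} (\<lambda>w. column k (sysB S)) (\<lambda>w. column k (sysB S')))
      = sysB S ** transpose (sysB S')"
    by (simp add: vec_eq_iff mult_transpose_cols_def column_def matrix_matrix_mult_def transpose_def)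
  then show ?thesis
    unfolding reach_gram_def mult_transpose_cols_words_Suc words_0 reach.simps list.sel col
      mult_transpose_cols_mult flow_def
    by (simp add: linear_sum[OF bounded_linear.linear[OF bounded_linear_sandwich], symmetric])
qed

lemma reach_gram_Suc:
  "reach_gram S S' (Suc (Suc i)) t
     = flow (sysA S) (sysA S') (t (Suc (Suc i))) (coupling (sysN S) (sysN S') (reach_gram S S' (Suc i) t))"
  unfolding reach_gram_def mult_transpose_cols_words_Suc[of "Suc i"] reach_Cons mult_transpose_cols_mult
    flow_def coupling_def linear_sum[OF bounded_linear.linear[OF bounded_linear_sandwich], symmetric] ..

lemma reach_gram_cong:
  "(\<And>k. k \<in> {1..Suc i} \<Longrightarrow> t k = t' k) \<Longrightarrow> reach_gram S S' (Suc i) t = reach_gram S S' (Suc i) t'"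
proof (induction i)
  case (Suc i)
  from Suc.IH Suc.prems have "reach_gram S S' (Suc i) t = reach_gram S S' (Suc i) t'" by simp
  then show ?case using Suc.prems[of "Suc (Suc i)"] by (simp only: reach_gram_Suc) simp
qed (simp only: reach_gram_1, simp)

lemma integrand_C_eq:
  "integrand_C S S' i t = (transpose (sysC S) ** sysC S') \<bullet> reach_gram S S' i t"
  by (simp add: integrand_C_def kernel_C_def mult_cols_def mult_transpose_cols_mult trace_sandwich
      flip: reach_gram_def)

text \<open>With both arguments equal to \<open>X\<close> this is the quadratic part of the trace formula.\<close>

definition output_form ::
  "('n::finite, 'm::finite, 'p::finite) bqo \<Rightarrow> ('r::finite, 'm, 'p) bqo \<Rightarrow> real^'r^'n \<Rightarrow> real^'r^'n \<Rightarrow> real" where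
  "output_form S S' U V = (\<Sum>j\<in>UNIV. (sysM S j ** U ** transpose (sysM S' j)) \<bullet> V)"

lemma bounded_bilinear_output_form: "bounded_bilinear (output_form S S')"
  unfolding bilinear_conv_bounded_bilinear[symmetric] bilinear_def output_form_def
  by (intro conjI allI bounded_linear.linear bounded_linear_sum bounded_linear_inner_right
      bounded_linear_compose[OF bounded_linear_inner_left bounded_linear_sandwich])

text \<open>Component \<open>l\<close> of the mixed kernel in column \<open>(c, d)\<close> is \<open>y\<^sub>d\<^sup>T M\<^sub>l x\<^sub>c\<close>, with the columns \<open>x\<^sub>c\<close>, \<open>y\<^sub>d\<close> of the
two reachability mappings. The sum over \<open>c\<close> and \<open>d\<close> of products of two such terms is bilinear in the two
Gram matrices.\<close>

lemma integrand_M_eq: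
  fixes S :: "('n::finite, 'm::finite, 'p::finite) bqo" and S' :: "('r::finite, 'm, 'p) bqo"
  shows "integrand_M S S' i j (t, s) = output_form S S' (reach_gram S S' i t) (reach_gram S S' j s)"
proof -
  have ker: "(frakM S *v kron_cols F G (c, d)) $ l = (sysM S l *v F c) \<bullet> G d"
    for S :: "('x::finite, 'y::finite, 'p) bqo" and F G and c d :: "'y list" and l
  proof -
    have "(frakM S *v kron_cols F G (c, d)) $ l
        = (\<Sum>(a, b)\<in>UNIV \<times> UNIV. sysM S l $ b $ a * (F c $ a * G d $ b))"
      by (simp add: frakM_def vec_mat_def kron_cols_def matrix_vector_mult_def case_prod_unfold)
    also have "\<dots> = (\<Sum>b\<in>UNIV. \<Sum>a\<in>UNIV. sysM S l $ b $ a * (F c $ a * G d $ b))"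
      by (subst sum.cartesian_product[symmetric]) (rule sum.swap)
    finally show ?thesis
      by (simp add: inner_vec_def matrix_vector_mult_def sum_distrib_left sum_distrib_right mult_ac)
  qed
  have "integrand_M S S' i j (t, s)
      = (\<Sum>l\<in>UNIV. \<Sum>(c, d)\<in>words i \<times> words j.
          ((sysM S l *v reach S i t c) \<bullet> reach S j s d) * ((sysM S' l *v reach S' i t c) \<bullet> reach S' j s d))"
    by (simp add: integrand_M_def trace_def mult_transpose_cols_def kernel_M_def mult_cols_def ker case_prod_unfold
        flip: surjective_pairing)
       (intro sum.cong refl, metis ker prod.collapse)
  then show ?thesis
    by (simp add: output_form_def reach_gram_def inner_mult_transpose_cols sum.cartesian_product
        flip: mult_transpose_cols_mult)
qed

section \<open>Integrating the Gram matrices over the time orthants\<close>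

lemma time_measure_sigma_finite: "sigma_finite_measure (time_measure i)"
proof -
  interpret product_sigma_finite "\<lambda>k::nat. lborel :: real measure" by standard
  interpret finite_product_sigma_finite "\<lambda>k::nat. lborel :: real measure" "{1..i}" by standard simp
  show ?thesis unfolding time_measure_def by (rule sigma_finite_measure_axioms)
qed

lemma time_orthant_sets: "time_orthant i \<in> sets (time_measure i)"
  unfolding time_orthant_def time_measure_def by (rule sets_PiM_I_finite) auto

lemma indicator_time_orthant:
  "t \<in> space (time_measure i) \<Longrightarrow> indicator (time_orthant i) t = (\<Prod>k\<in>{1..i}. indicator {0..} (t k) :: real)"
  by (auto simp: time_measure_def time_orthant_def space_PiM PiE_def Pi_def indicator_def intro!: prod_zero[symmetric])

context bqo_pair
begin

text \<open>The measurability is stated on every larger time space, since the recursion for \<open>i + 1\<close> time variables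
evaluates the Gram matrix of the first \<open>i\<close> variables at a point with more coordinates.\<close>

lemma reach_gram_measurable:
  "Suc i \<le> j \<Longrightarrow> reach_gram S S' (Suc i) \<in> borel_measurable (time_measure j)"
proof (induction i)
  case 0
  then have [measurable]: "(\<lambda>t. t 1) \<in> borel_measurable (time_measure j)"
    unfolding time_measure_def by (auto intro!: measurable_component_singleton[where M = "\<lambda>_. lborel", simplified])
  show ?case unfolding reach_gram_1[abs_def] by measurable
next
  case (Suc i)
  have [measurable]: "(\<lambda>t. t (Suc (Suc i))) \<in> borel_measurable (time_measure j)"
    unfolding time_measure_def using Suc.prems
    by (auto intro!: measurable_component_singleton[where M = "\<lambda>_. lborel", simplified])
  have [measurable]: "(\<lambda>t. coupling (sysN S) (sysN S') (reach_gram S S' (Suc i) t)) \<in> borel_measurable (time_measure j)"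
    using Suc by (intro borel_measurable_continuous_on[OF linear_continuous_on[OF bounded_linear_coupling]]) auto
  show ?case unfolding reach_gram_Suc[abs_def] by measurable
qed

lemma spectral_norm_reach_gram:
  "\<exists>K\<ge>0. \<forall>t. (\<forall>k\<in>{1..Suc i}. 0 \<le> t k) \<longrightarrow>
     spectral_norm (reach_gram S S' (Suc i) t) \<le> K * (\<Prod>k\<in>{1..Suc i}. exp (- (\<alpha> + \<alpha>') * t k))"
proof (induction i)
  case 0
  let ?Z = "sysB S ** transpose (sysB S')"
  have "spectral_norm (\<Phi> (t 1) ?Z) \<le> \<beta> * \<beta>' * spectral_norm ?Z * exp (- (\<alpha> + \<alpha>') * t 1)"
    if "0 \<le> t 1" for t :: "nat \<Rightarrow> real"
    using spectral_norm_flow[OF that, of ?Z] by (simp only: mult_ac)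
  moreover have "0 \<le> \<beta> * \<beta>' * spectral_norm ?Z"
    using pos by (intro mult_nonneg_nonneg spectral_norm_nonneg) auto
  ultimately show ?case
    by (intro exI[of _ "\<beta> * \<beta>' * spectral_norm ?Z"]) (simp add: reach_gram_1)
next
  case (Suc i)
  then obtain K where K: "0 \<le> K" "\<And>t. (\<forall>k\<in>{1..Suc i}. 0 \<le> t k) \<Longrightarrow>
     spectral_norm (reach_gram S S' (Suc i) t) \<le> K * (\<Prod>k\<in>{1..Suc i}. exp (- (\<alpha> + \<alpha>') * t k))"
    by blast
  define L where "L = spectral_norm (calN S) * spectral_norm (calN S')"
  have L: "0 \<le> L" unfolding L_def by (intro mult_nonneg_nonneg spectral_norm_nonneg)
  show ?case
  proof (intro exI[of _ "\<beta> * \<beta>' * L * K"] conjI allI impI)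
    show "0 \<le> \<beta> * \<beta>' * L * K" using pos K L by simp
    fix t :: "nat \<Rightarrow> real" assume t: "\<forall>k\<in>{1..Suc (Suc i)}. 0 \<le> t k"
    let ?e = "exp (- (\<alpha> + \<alpha>') * t (Suc (Suc i)))" and ?p = "\<Prod>k\<in>{1..Suc i}. exp (- (\<alpha> + \<alpha>') * t k)"
    have "spectral_norm (reach_gram S S' (Suc (Suc i)) t)
        \<le> \<beta> * \<beta>' * ?e * spectral_norm (\<N> (reach_gram S S' (Suc i) t))"
      unfolding reach_gram_Suc using t by (intro spectral_norm_flow) auto
    also have "\<dots> \<le> \<beta> * \<beta>' * ?e * (L * spectral_norm (reach_gram S S' (Suc i) t))"
      unfolding L_def calN_def using pos by (intro mult_left_mono spectral_norm_coupling) auto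
    also have "\<dots> \<le> \<beta> * \<beta>' * ?e * (L * (K * ?p))"
      using pos L t by (intro mult_left_mono K) auto
    also have "\<dots> = \<beta> * \<beta>' * L * K * (?p * ?e)" by (simp only: mult_ac)
    also have "?p * ?e = (\<Prod>k\<in>{1..Suc (Suc i)}. exp (- (\<alpha> + \<alpha>') * t k))"
      by (subst (2) prod.nat_ivl_Suc') simp_all
    finally show "spectral_norm (reach_gram S S' (Suc (Suc i)) t)
        \<le> \<beta> * \<beta>' * L * K * (\<Prod>k\<in>{1..Suc (Suc i)}. exp (- (\<alpha> + \<alpha>') * t k))" .
  qed
qed

text \<open>The integrable majorant is a product of exponentials, one for each time variable.\<close>

lemma reach_gram_integrable:
  "integrable (time_measure (Suc i)) (\<lambda>t. indicator (time_orthant (Suc i)) t *\<^sub>R reach_gram S S' (Suc i) t)"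
proof -
  obtain K where K: "0 \<le> K" "\<And>t. (\<forall>k\<in>{1..Suc i}. 0 \<le> t k) \<Longrightarrow>
     spectral_norm (reach_gram S S' (Suc i) t) \<le> K * (\<Prod>k\<in>{1..Suc i}. exp (- (\<alpha> + \<alpha>') * t k))"
    using spectral_norm_reach_gram by blast
  let ?C = "real CARD('n) * real CARD('r) * K"
  let ?e = "\<lambda>s. indicator {0..} s * exp (- (\<alpha> + \<alpha>') * s)"
  interpret product_sigma_finite "\<lambda>k::nat. lborel :: real measure" by standard
  have "integrable lborel ?e"
    using has_bochner_integral_exp_halfline[of "\<alpha> + \<alpha>'"] pos by (auto simp: has_bochner_integral_iff)
  then have "integrable (time_measure (Suc i)) (\<lambda>t. \<Prod>k\<in>{1..Suc i}. ?e (t k))"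
    unfolding time_measure_def by (intro product_integrable_prod) auto
  then have "integrable (time_measure (Suc i)) (\<lambda>t. ?C * (\<Prod>k\<in>{1..Suc i}. ?e (t k)))"
    by (rule integrable_mult_right)
  then show ?thesis
  proof (rule Bochner_Integration.integrable_bound)
    show "(\<lambda>t. indicator (time_orthant (Suc i)) t *\<^sub>R reach_gram S S' (Suc i) t)
        \<in> borel_measurable (time_measure (Suc i))"
      using time_orthant_sets reach_gram_measurable by (intro borel_measurable_scaleR borel_measurable_indicator) auto
    show "AE t in time_measure (Suc i). norm (indicator (time_orthant (Suc i)) t *\<^sub>R reach_gram S S' (Suc i) t)
        \<le> norm (?C * (\<Prod>k\<in>{1..Suc i}. ?e (t k)))"
    proof (rule AE_I2)
      fix t assume t: "t \<in> space (time_measure (Suc i))"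
      show "norm (indicator (time_orthant (Suc i)) t *\<^sub>R reach_gram S S' (Suc i) t)
        \<le> norm (?C * (\<Prod>k\<in>{1..Suc i}. ?e (t k)))"
      proof (cases "t \<in> time_orthant (Suc i)")
        case True
        then have t0: "\<forall>k\<in>{1..Suc i}. 0 \<le> t k" by (auto simp: time_orthant_def PiE_def Pi_def)
        then have e: "(\<Prod>k\<in>{1..Suc i}. ?e (t k)) = (\<Prod>k\<in>{1..Suc i}. exp (- (\<alpha> + \<alpha>') * t k))"
          by (intro prod.cong) auto
        have "norm (reach_gram S S' (Suc i) t)
            \<le> real CARD('n) * real CARD('r) * spectral_norm (reach_gram S S' (Suc i) t)"
          by (rule norm_le_spectral_norm)
        also have "\<dots> \<le> real CARD('n) * real CARD('r) * (K * (\<Prod>k\<in>{1..Suc i}. exp (- (\<alpha> + \<alpha>') * t k)))"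
          by (intro mult_left_mono K t0) auto
        finally have "norm (reach_gram S S' (Suc i) t) \<le> ?C * (\<Prod>k\<in>{1..Suc i}. ?e (t k))"
          unfolding e by (simp only: mult.assoc)
        then show ?thesis
          using True by (simp only: indicator_simps scaleR_one real_norm_def order_trans[OF _ abs_ge_self])
      qed simp
    qed
  qed
qed

text \<open>Fubini: integrating out the last time variable applies \<open>\<T> \<circ> \<N>\<close> to the Gram matrix of the remaining variables,
and this bounded operator commutes with their integral.\<close>

lemma integral_reach_gram:
  "(LINT t|time_measure (Suc i). indicator (time_orthant (Suc i)) t *\<^sub>R reach_gram S S' (Suc i) t) = gramian_term i"
proof (induction i)
  case 0
  interpret product_sigma_finite "\<lambda>k::nat. lborel :: real measure" by standard
  let ?f = "\<lambda>s. indicator {0..} s *\<^sub>R \<Phi> s (sysB S ** transpose (sysB S'))"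
  have "(LINT t|time_measure 1. indicator (time_orthant 1) t *\<^sub>R reach_gram S S' 1 t) = (LINT t|time_measure 1. ?f (t 1))"
    by (intro Bochner_Integration.integral_cong refl) (simp add: indicator_time_orthant reach_gram_1)
  also have "\<dots> = (LINT s|lborel. ?f s)"
    unfolding time_measure_def atLeastAtMost_singleton by (rule product_integral_singleton) measurable
  finally show ?case by (simp add: flow_integral_def set_lebesgue_integral_def)
next
  case (Suc i)
  interpret product_sigma_finite "\<lambda>k::nat. lborel :: real measure" by standard
  let ?G = "\<lambda>j t. indicator (time_orthant (Suc j)) t *\<^sub>R reach_gram S S' (Suc j) t"
  have ins: "{1..Suc (Suc i)} = insert (Suc (Suc i)) {1..Suc i}" by auto
  have TN: "bounded_linear (\<lambda>Z. \<T> (\<N> Z))"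
    using linear_compose[OF bounded_linear.linear[OF bounded_linear_coupling] linear_flow_integral]
    by (simp add: linear_conv_bounded_linear o_def)
  have "(LINT t|time_measure (Suc (Suc i)). ?G (Suc i) t)
      = (LINT t|time_measure (Suc i). LINT s|lborel. ?G (Suc i) (t(Suc (Suc i) := s)))"
    using reach_gram_integrable[of "Suc i"] unfolding time_measure_def ins
    by (intro product_integral_insert) auto
  also have "\<dots> = (LINT t|time_measure (Suc i). \<T> (\<N> (?G i t)))"
  proof (intro Bochner_Integration.integral_cong refl)
    fix t assume t: "t \<in> space (time_measure (Suc i))"
    have "?G (Suc i) (t(Suc (Suc i) := s))
        = indicator (time_orthant (Suc i)) t *\<^sub>R (indicator {0..} s *\<^sub>R \<Phi> s (\<N> (reach_gram S S' (Suc i) t)))" for s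
    proof -
      have sp: "t(Suc (Suc i) := s) \<in> space (time_measure (Suc (Suc i)))"
        using t by (auto simp: time_measure_def space_PiM PiE_def extensional_def)
      have "(\<Prod>k\<in>{1..Suc i}. indicator {0..} ((t(Suc (Suc i) := s)) k) :: real) = (\<Prod>k\<in>{1..Suc i}. indicator {0..} (t k))"
        by (intro prod.cong) auto
      then have ind: "indicator (time_orthant (Suc (Suc i))) (t(Suc (Suc i) := s))
          = indicator (time_orthant (Suc i)) t * (indicator {0..} s :: real)"
        unfolding indicator_time_orthant[OF sp] indicator_time_orthant[OF t] ins by (simp add: mult.commute)
      have "reach_gram S S' (Suc i) (t(Suc (Suc i) := s)) = reach_gram S S' (Suc i) t"
        by (rule reach_gram_cong) auto
      then show ?thesis unfolding ind reach_gram_Suc by simp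
    qed
    then have "(LINT s|lborel. ?G (Suc i) (t(Suc (Suc i) := s)))
        = indicator (time_orthant (Suc i)) t *\<^sub>R \<T> (\<N> (reach_gram S S' (Suc i) t))"
      by (simp only: flow_integral_def set_lebesgue_integral_def integral_scaleR_right)
    also have "\<dots> = \<T> (\<N> (?G i t))"
      by (simp add: linear_scale[OF bounded_linear.linear[OF TN]])
    finally show "(LINT s|lborel. ?G (Suc i) (t(Suc (Suc i) := s))) = \<T> (\<N> (?G i t))" .
  qed
  also have "\<dots> = \<T> (\<N> (LINT t|time_measure (Suc i). ?G i t))"
    by (rule integral_bounded_linear[OF TN reach_gram_integrable])
  finally show ?case by (simp add: Suc)
qed

section \<open>The H2 inner product\<close>

lemma h2_term_C:
  "set_integrable (time_measure (Suc i)) (time_orthant (Suc i)) (integrand_C S S' (Suc i))"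
  "h2_term_C S S' (Suc i) = (transpose (sysC S) ** sysC S') \<bullet> gramian_term i"
proof -
  have eq: "indicator (time_orthant (Suc i)) t *\<^sub>R integrand_C S S' (Suc i) t
      = (transpose (sysC S) ** sysC S') \<bullet> (indicator (time_orthant (Suc i)) t *\<^sub>R reach_gram S S' (Suc i) t)" for t
    by (simp add: integrand_C_eq)
  show "set_integrable (time_measure (Suc i)) (time_orthant (Suc i)) (integrand_C S S' (Suc i))"
    unfolding set_integrable_def eq
    by (rule integrable_bounded_linear[OF bounded_linear_inner_right reach_gram_integrable])
  show "h2_term_C S S' (Suc i) = (transpose (sysC S) ** sysC S') \<bullet> gramian_term i"
    unfolding h2_term_C_def set_lebesgue_integral_def eq
      integral_bounded_linear[OF bounded_linear_inner_right reach_gram_integrable] integral_reach_gram ..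
qed

lemma h2_term_M:
  "set_integrable (time_measure (Suc i) \<Otimes>\<^sub>M time_measure (Suc j)) (time_orthant (Suc i) \<times> time_orthant (Suc j))
     (integrand_M S S' (Suc i) (Suc j))"
  "h2_term_M S S' (Suc i) (Suc j) = output_form S S' (gramian_term i) (gramian_term j)"
proof -
  interpret form: bounded_bilinear "output_form S S'" by (rule bounded_bilinear_output_form)
  let ?G = "\<lambda>j t. indicator (time_orthant (Suc j)) t *\<^sub>R reach_gram S S' (Suc j) t"
  have eq: "indicator (time_orthant (Suc i) \<times> time_orthant (Suc j)) p *\<^sub>R integrand_M S S' (Suc i) (Suc j) p
      = output_form S S' (?G i (fst p)) (?G j (snd p))" for p
    by (cases p) (simp add: integrand_M_eq indicator_times form.scaleR_left form.scaleR_right)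
  note prod = pair_integral_bounded_bilinear[OF bounded_bilinear_output_form time_measure_sigma_finite
      time_measure_sigma_finite reach_gram_integrable reach_gram_integrable]
  show "set_integrable (time_measure (Suc i) \<Otimes>\<^sub>M time_measure (Suc j)) (time_orthant (Suc i) \<times> time_orthant (Suc j))
     (integrand_M S S' (Suc i) (Suc j))"
    unfolding set_integrable_def eq by (rule prod)
  show "h2_term_M S S' (Suc i) (Suc j) = output_form S S' (gramian_term i) (gramian_term j)"
    unfolding h2_term_M_def set_lebesgue_integral_def eq prod integral_reach_gram ..
qed

lemma gramian_has_sum: "(gramian_term has_sum gramian) UNIV"
  by (rule norm_summable_imp_has_sum[OF summable_norm_gramian_term gramian_sums])

text \<open>The linear kernels contribute a linear functional of the Neumann terms, the mixed kernels a bilinear form of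
two of them. Since the terms are absolutely summable, both sums can be taken inside.\<close>

lemma h2_inner_eq:
  "h2_inner_converges S S'"
  "h2_inner S S' = (transpose (sysC S) ** sysC S') \<bullet> gramian + output_form S S' gramian gramian"
proof -
  have abs: "(\<lambda>i. norm (gramian_term i)) summable_on UNIV"
    using summable_norm_gramian_term by (intro norm_summable_imp_summable_on) simp
  note form = infsum_bounded_bilinear[OF bounded_bilinear_output_form[of S S'] abs abs]
  \<comment> \<open>The Neumann terms count from 0, the kernels from 1.\<close>
  have range: "{1..} = range Suc" by (auto simp: image_iff Suc_le_eq gr0_conv_Suc)
  have range2: "{1..} \<times> {1..} = map_prod Suc Suc ` (UNIV \<times> UNIV)" by (simp only: range map_prod_surj_on)
  have inj: "inj_on (map_prod Suc Suc) (UNIV \<times> UNIV)" by (auto simp: inj_on_def)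
  have C: "((\<lambda>i. h2_term_C S S' i) has_sum (transpose (sysC S) ** sysC S') \<bullet> gramian) {1..}"
    unfolding range has_sum_reindex[OF inj_Suc] o_def h2_term_C
    by (rule has_sum_bounded_linear[OF bounded_linear_inner_right gramian_has_sum, unfolded o_def])
  have "((\<lambda>(i, j). output_form S S' (gramian_term i) (gramian_term j)) has_sum output_form S S' gramian gramian) (UNIV \<times> UNIV)"
    using has_sum_infsum[OF form(1)] unfolding form(2) infsumI[OF gramian_has_sum] .
  then have M: "((\<lambda>(i, j). h2_term_M S S' i j) has_sum output_form S S' gramian gramian) ({1..} \<times> {1..})"
    unfolding range2 has_sum_reindex[OF inj] o_def
    by (simp add: case_prod_unfold h2_term_M)
  show "h2_inner S S' = (transpose (sysC S) ** sysC S') \<bullet> gramian + output_form S S' gramian gramian"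
    unfolding h2_inner_def infsumI[OF C] infsumI[OF M] ..
  have "set_integrable (time_measure i) (time_orthant i) (integrand_C S S' i)" if "1 \<le> i" for i
    using that h2_term_C(1)[of "i - 1"] by simp
  moreover have "set_integrable (time_measure i \<Otimes>\<^sub>M time_measure j) (time_orthant i \<times> time_orthant j)
      (integrand_M S S' i j)" if "1 \<le> i" "1 \<le> j" for i j
    using that h2_term_M(1)[of "i - 1" "j - 1"] by simp
  ultimately show "h2_inner_converges S S'"
    unfolding h2_inner_converges_def using has_sum_imp_summable[OF C] has_sum_imp_summable[OF M] by blast
qed

end

context bqo_pair
begin

lemma X_equation_iff: "X_equation S S' X \<longleftrightarrow> lyapunov X = - (sysB S ** transpose (sysB S'))"
  unfolding eq_neg_iff_add_eq_0 X_equation_def lyapunov_def sylvester_def coupling_def ..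

lemma Y_equation_iff:
  "Y_equation S S' X Y
     \<longleftrightarrow> lyapunov_adjoint Y = (\<Sum>j\<in>UNIV. sysM S j ** X ** sysM S' j) + transpose (sysC S) ** sysC S'"
  by (simp only: Y_equation_def lyapunov_adjoint_def diff_diff_eq right_minus_eq)

lemma unique_solution_gramian: "unique_solution (X_equation S S') gramian"
  unfolding unique_solution_def X_equation_iff lyapunov_gramian[symmetric] inj_eq[OF inj_lyapunov]
  by simp

lemma ex_unique_solution_Y: "\<exists>Y. unique_solution (Y_equation S S' X) Y"
proof -
  obtain Y where Y: "(\<Sum>j\<in>UNIV. sysM S j ** X ** sysM S' j) + transpose (sysC S) ** sysC S' = lyapunov_adjoint Y"
    by (rule surjE[OF bij_is_surj[OF bij_lyapunov_adjoint]])
  show ?thesis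
    unfolding unique_solution_def Y_equation_iff Y inj_eq[OF bij_is_inj[OF bij_lyapunov_adjoint]]
    by simp
qed

lemma h2_inner_trace:
  assumes "bqo_system S'"
  shows "h2_inner S S' = trace (sysC S ** gramian ** transpose (sysC S'))
    + (\<Sum>j\<in>UNIV. trace (transpose gramian ** sysM S j ** gramian ** sysM S' j))"
proof -
  have M: "transpose (sysM S' j) = sysM S' j" for j
    using assms unfolding bqo_system_def by blast
  have "trace (transpose gramian ** sysM S j ** gramian ** sysM S' j)
      = (sysM S j ** gramian ** transpose (sysM S' j)) \<bullet> gramian" for j
    unfolding M using trace_transpose_mult[of gramian "sysM S j ** gramian ** sysM S' j"]
    by (simp only: matrix_mul_assoc inner_commute)
  then show ?thesis by (simp only: h2_inner_eq(2) output_form_def trace_sandwich)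
qed

text \<open>The value is \<open>\<langle>X, L\<^sup>* Y\<rangle> = \<langle>L X, Y\<rangle> = - \<langle>B B'\<^sup>T, Y\<rangle>\<close> for the generalized Lyapunov operator \<open>L\<close>: the right-hand side
of the equation for \<open>Y\<close> is built so that its inner product with \<open>X\<close> is the H2 inner product.\<close>

lemma h2_inner_dual:
  assumes "bqo_system S'" "Y_equation S S' gramian Y"
  shows "h2_inner S S' = - trace (transpose (sysB S) ** Y ** sysB S')"
proof -
  have "h2_inner S S' = gramian \<bullet> lyapunov_adjoint Y"
  proof -
    have M: "transpose (sysM S' j) = sysM S' j" for j
      using assms(1) unfolding bqo_system_def by blast
    show ?thesis
      unfolding assms(2)[unfolded Y_equation_iff] h2_inner_eq(2) output_form_def M inner_commute[of gramian]
      by (simp only: inner_add_left inner_sum_left add.commute)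
  qed
  also have "\<dots> = - (sysB S ** transpose (sysB S')) \<bullet> Y"
    by (simp add: lyapunov_gramian flip: inner_lyapunov)
  also have "\<dots> = - trace (transpose (sysB S) ** Y ** sysB S')"
    by (simp only: inner_minus_left inner_matrix_mult_right[of "sysB S"] transpose_transpose
        trace_transpose_mult matrix_mul_assoc[symmetric])
  finally show ?thesis .
qed

end

lemma trace_mult_transpose_cols_self_nonneg: "0 \<le> trace (mult_transpose_cols W F F)"
  by (auto simp: trace_def mult_transpose_cols_def intro!: sum_nonneg)

text \<open>Needed to undo the square root in the definition of the H2 norm.\<close>

lemma h2_inner_self_nonneg: "0 \<le> h2_inner S S"
proof -
  have "0 \<le> integrand_C S S i t" "0 \<le> integrand_M S S i j ts" for i j t ts
    by (simp_all add: integrand_C_def integrand_M_def case_prod_unfold trace_mult_transpose_cols_self_nonneg)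
  then have "0 \<le> h2_term_C S S i" "0 \<le> h2_term_M S S i j" for i j
    unfolding h2_term_C_def h2_term_M_def set_lebesgue_integral_def
    by (auto intro!: Bochner_Integration.integral_nonneg)
  then show ?thesis unfolding h2_inner_def
    by (intro add_nonneg_nonneg infsum_nonneg) (auto simp: case_prod_unfold)
qed

section \<open>The case of equal systems\<close>

text \<open>Together with uniqueness this makes the Gramian \<open>P\<close> symmetric, so that \<open>P\<^sup>T\<close> may be replaced by \<open>P\<close> in the trace formula.\<close>

lemma P_equation_transpose: "P_equation S P \<Longrightarrow> P_equation S (transpose P)"
proof -
  note lin = bounded_linear.linear[OF bounded_linear_transpose]
  assume "P_equation S P"
  then have "transpose (sysA S ** P + P ** transpose (sysA S)
     + (\<Sum>k\<in>UNIV. sysN S k ** P ** transpose (sysN S k)) + sysB S ** transpose (sysB S)) = 0"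
    by (simp add: P_equation_def linear_0[OF lin])
  then show ?thesis
    by (simp add: P_equation_def linear_add[OF lin] linear_sum[OF lin] matrix_transpose_mul matrix_mul_assoc add_ac)
qed

lemma X_equation_self: "X_equation S S = P_equation S"
  by (simp add: fun_eq_iff X_equation_def P_equation_def)

lemma Y_equation_self: "Y_equation S S P Y \<longleftrightarrow> Q_equation S P (- Y)"
proof -
  have neg: "A ** (- Z) = - (A ** Z)" "(- Z) ** B = - (Z ** B)" for A B Z :: "real^'n^'n"
    using bounded_bilinear.minus_left[OF bounded_bilinear_matrix_mult]
      bounded_bilinear.minus_right[OF bounded_bilinear_matrix_mult] by blast+
  show ?thesis
    unfolding Y_equation_def Q_equation_def neg sum_negf
    by (subst neg_equal_0_iff_equal[symmetric]) (simp add: algebra_simps)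
qed

theorem theorem4p2:
  fixes S :: "('n::finite, 'm::finite, 'p::finite) bqo"
    and S' :: "('r::finite, 'm, 'p) bqo"
    and \<alpha> \<beta> \<alpha>' \<beta>' :: real
  assumes "bqo_system S" and "bqo_system S'"
    and "stable_mat (sysA S)" and "stable_mat (sysA S')"
    and "stability_params (sysA S) \<alpha> \<beta>" and "stability_params (sysA S') \<alpha>' \<beta>'"
    and "(spectral_norm (calN S))\<^sup>2 < 2 * \<alpha> / \<beta>\<^sup>2"
    and "(spectral_norm (calN_T S))\<^sup>2 < 2 * \<alpha> / \<beta>\<^sup>2"
    and "(spectral_norm (calN S'))\<^sup>2 < 2 * \<alpha>' / \<beta>'\<^sup>2"
    and "(spectral_norm (calN_T S'))\<^sup>2 < 2 * \<alpha>' / \<beta>'\<^sup>2"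
  shows
    "(\<exists>X Y. unique_solution (X_equation S S') X \<and>
        unique_solution (Y_equation S S' X) Y \<and>
        h2_inner_converges S S' \<and>
        h2_inner S S' = trace (sysC S ** X ** transpose (sysC S'))
          + (\<Sum>j\<in>UNIV. trace (transpose X ** sysM S j ** X ** sysM S' j)) \<and>
        h2_inner S S' = - trace (transpose (sysB S) ** Y ** sysB S'))
     \<and>
     (\<exists>P Q. unique_solution (P_equation S) P \<and>
        unique_solution (Q_equation S P) Q \<and>
        unique_solution (X_equation S S) P \<and>
        unique_solution (Y_equation S S P) (- Q) \<and>
        h2_inner_converges S S \<and>
        (h2_norm S)\<^sup>2 = trace (sysC S ** P ** transpose (sysC S))
          + (\<Sum>j\<in>UNIV. trace (P ** sysM S j ** P ** sysM S j)) \<and>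
        (h2_norm S)\<^sup>2 = trace (transpose (sysB S) ** Q ** sysB S))"
proof
  interpret bqo_pair S S' \<alpha> \<beta> \<alpha>' \<beta>' by standard (use assms in auto)
  obtain Y where Y: "unique_solution (Y_equation S S' gramian) Y" using ex_unique_solution_Y by blast
  then have "Y_equation S S' gramian Y" by (simp add: unique_solution_def)
  with Y unique_solution_gramian h2_inner_eq(1) h2_inner_trace h2_inner_dual assms(2)
  show "\<exists>X Y. unique_solution (X_equation S S') X \<and>
        unique_solution (Y_equation S S' X) Y \<and>
        h2_inner_converges S S' \<and>
        h2_inner S S' = trace (sysC S ** X ** transpose (sysC S'))
          + (\<Sum>j\<in>UNIV. trace (transpose X ** sysM S j ** X ** sysM S' j)) \<and>
        h2_inner S S' = - trace (transpose (sysB S) ** Y ** sysB S')"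
    by blast
next
  interpret bqo_pair S S \<alpha> \<beta> \<alpha> \<beta> by standard (use assms in auto)
  obtain Y where Y: "unique_solution (Y_equation S S gramian) Y" using ex_unique_solution_Y by blast
  define Q where "Q = - Y"
  have Y_eq: "Y = - Q" by (simp add: Q_def)
  have X: "unique_solution (P_equation S) gramian"
    using unique_solution_gramian by (simp add: X_equation_self)
  then have sym: "transpose gramian = gramian"
    using P_equation_transpose by (auto simp: unique_solution_def)
  have Q: "unique_solution (Q_equation S gramian) Q"
    using Y unfolding unique_solution_def Y_equation_self Y_eq
    by (metis minus_minus)
  have B: "trace (transpose (sysB S) ** (- Q) ** sysB S) = - trace (transpose (sysB S) ** Q ** sysB S)"
    by (simp add: bounded_bilinear.minus_left[OF bounded_bilinear_matrix_mult]
      bounded_bilinear.minus_right[OF bounded_bilinear_matrix_mult]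
      linear_neg[OF bounded_linear.linear[OF bounded_linear_trace]])
  have sq: "(h2_norm S)\<^sup>2 = h2_inner S S" by (simp add: h2_norm_def h2_inner_self_nonneg)
  have "h2_inner S S = trace (transpose (sysB S) ** Q ** sysB S)"
    using h2_inner_dual[of Y] Y assms(1) by (simp add: unique_solution_def Y_eq B)
  with X Q Y h2_inner_eq(1) h2_inner_trace[OF assms(1)]
  show "\<exists>P Q. unique_solution (P_equation S) P \<and>
        unique_solution (Q_equation S P) Q \<and>
        unique_solution (X_equation S S) P \<and>
        unique_solution (Y_equation S S P) (- Q) \<and>
        h2_inner_converges S S \<and>
        (h2_norm S)\<^sup>2 = trace (sysC S ** P ** transpose (sysC S))
          + (\<Sum>j\<in>UNIV. trace (P ** sysM S j ** P ** sysM S j)) \<and>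
        (h2_norm S)\<^sup>2 = trace (transpose (sysB S) ** Q ** sysB S)"
    unfolding sq X_equation_self Y_eq sym by blast
qed

end
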